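(* Let $r_1,r_2$ be real numbers with $r_1<\frac14$, $r_2<\frac14$, and take $\rho_1=-r_1$, $\rho_2=-r_2$ (or $\rho_1=-r_2$, $\rho_2=-r_1$). Let $P_n$ be the monic polynomial eigenfunctions (Bannai-Ito polynomials) of the Dunkl shift operator $L$ defined in the context, and put $\tilde S_n(x)=i^{-n}P_n(ix-\frac14)$, $a=\frac12-2r_1$, $b=\frac12-2r_2$. Then $\tilde S_{n+1}(x)+\tilde u_n\tilde S_{n-1}(x)=x\tilde S_n(x)$ with $$\tilde u_n=\begin{cases}\frac{n(n-4(r_1+r_2))}{16},& n\text{ even},\\ \frac{(n-4r_1)(n-4r_2)}{16},& n\text{ odd},\end{cases}$$ and $\tilde u_n>0$ for all $n\ge1$. Explicitly, for $n=0,1,2,\dots$, $$\tilde S_{2n}(x)=(-1)^n2^{-2n}(a)_n(a+b)_n\;{}_3F_2\!\left({-n,\ a+2ix,\ a-2ix\atop a,\ a+b};1\right),$$ $$\tilde S_{2n+1}(x)=(-1)^n2^{-2n}(a+1)_n(a+b)_n\;x\;{}_3F_2\!\left({-n,\ a+2ix,\ a-2ix\atop a+1,\ a+b};1\right),$$ (i.e. they are expressed through continuous dual Hahn polynomials), and they are orthogonal on the whole real line with a positive weight: $$\int_{-\infty}^{\infty}w(x)\tilde S_n(x)\tilde S_m(x)\,dx=0\quad(n\ne m),\qquad w(x)=\left|\frac{\Gamma(a+2ix)\,\Gamma(b+2ix)}{\Gamma(\frac12+2ix)}\right|^2 .$$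
   Context: For real parameters $r_1,r_2,\rho_1,\rho_2$ the Dunkl shift operator $L$ acts on polynomials by $$Lf(x)=\frac{(x-\rho_1)(x-\rho_2)}{2x}(f(x)-f(-x))+\frac{(x-r_1+1/2)(x-r_2+1/2)}{2x+1}(f(-x-1)-f(x)).$$ It maps polynomials to polynomials and $Lx^n=\lambda_nx^n+O(x^{n-1})$ with $\lambda_n=n/2$ for even $n$ and $\lambda_n=r_1+r_2-\rho_1-\rho_2-(n+1)/2$ for odd $n$. If $r_1+r_2-\rho_1-\rho_2\notin\{1,2,\dots\}$ (which holds for the parameters here), the $\lambda_n$ are pairwise distinct, and $P_n$ denotes the unique monic polynomial of degree $n$ with $LP_n=\lambda_nP_n$. $(a)_n=a(a+1)\cdots(a+n-1)$. The (unnormalized) continuous dual Hahn polynomials are $C_n(x^2;a,b,c)={}_3F_2\left({-n,a+ix,a-ix\atop a+b,a+c};1\right)$. *)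

theory Defs
  imports "HOL-Analysis.Analysis" "HOL-Computational_Algebra.Polynomial"
begin

text \<open>
  The Dunkl shift operator as a map on polynomials. Both divisions are exact: \<open>f(x) - f(-x)\<close>
  vanishes at \<open>x = 0\<close> and \<open>f(-x-1) - f(x)\<close> vanishes at \<open>x = -1/2\<close>. The lemma \<open>poly_dunkl_shift\<close>
  below recovers the pointwise formula.
\<close>

definition dunkl_shift :: "real \<Rightarrow> real \<Rightarrow> real \<Rightarrow> real \<Rightarrow> complex poly \<Rightarrow> complex poly" where
  "dunkl_shift r1 r2 \<rho>1 \<rho>2 f =
     ([:- of_real \<rho>1, 1:] * [:- of_real \<rho>2, 1:] * (f - f \<circ>\<^sub>p [:0, -1:])) div [:0, 2:]
   + ([:- of_real r1 + 1/2, 1:] * [:- of_real r2 + 1/2, 1:] * (f \<circ>\<^sub>p [:-1, -1:] - f)) div [:1, 2:]"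

lemma poly_dunkl_shift:
  assumes "x \<noteq> 0" "x \<noteq> - 1/2"
  shows "poly (dunkl_shift r1 r2 \<rho>1 \<rho>2 f) x =
      (x - of_real \<rho>1) * (x - of_real \<rho>2) / (2 * x) * (poly f x - poly f (- x))
    + (x - of_real r1 + 1/2) * (x - of_real r2 + 1/2) / (2 * x + 1) * (poly f (- x - 1) - poly f x)"
proof -
  define A where "A = [:- of_real \<rho>1, 1:] * [:- of_real \<rho>2, 1:] * (f - f \<circ>\<^sub>p [:0, -1:])"
  define B where "B = [:- of_real r1 + 1/2, 1:] * [:- of_real r2 + 1/2, 1:] * (f \<circ>\<^sub>p [:-1, -1:] - f)"
  have "[:0, 1:] dvd A"
    using poly_eq_0_iff_dvd[of A 0] by (simp add: A_def poly_pcompose)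
  then have A: "[:0, 2:] dvd A"
    using smult_dvd[of "[:0, 1:]" A 2] by simp
  have "[:1/2, 1:] dvd B"
    using poly_eq_0_iff_dvd[of B "-1/2"] by (simp add: B_def poly_pcompose)
  then have B: "[:1, 2:] dvd B"
    using smult_dvd[of "[:1/2, 1:]" B 2] by simp
  have nz: "2 * x + 1 \<noteq> 0"
    using assms(2) by (metis add_eq_0_iff2 minus_divide_left nonzero_mult_div_cancel_left zero_neq_numeral)
  have "poly (A div [:0, 2:]) x = poly A x / (2 * x)"
    using assms(1) arg_cong[OF dvd_div_mult_self[OF A], of "\<lambda>p. poly p x"]
    by (simp add: field_simps)
  moreover have "poly (B div [:1, 2:]) x = poly B x / (2 * x + 1)"
    using nz arg_cong[OF dvd_div_mult_self[OF B], of "\<lambda>p. poly p x"]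
    by (simp add: nonzero_eq_divide_eq algebra_simps)
  ultimately have "poly (dunkl_shift r1 r2 \<rho>1 \<rho>2 f) x = poly A x / (2 * x) + poly B x / (2 * x + 1)"
    by (simp add: dunkl_shift_def A_def B_def)
  also have "poly A x = (x - of_real \<rho>1) * (x - of_real \<rho>2) * (poly f x - poly f (- x))"
    unfolding A_def poly_mult poly_diff poly_pcompose by (simp add: algebra_simps)
  also have "poly B x = (x - of_real r1 + 1/2) * (x - of_real r2 + 1/2) * (poly f (- x - 1) - poly f x)"
  proof -
    have "poly [:-1, -1:] x = - x - 1" by simp
    moreover have "poly [:- of_real r1 + 1/2, 1:] x = x - of_real r1 + 1/2"
      "poly [:- of_real r2 + 1/2, 1:] x = x - of_real r2 + 1/2" by simp_all
    ultimately show ?thesis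
      unfolding B_def poly_mult poly_diff poly_pcompose by (simp only:)
  qed
  finally show ?thesis by simp
qed

definition dunkl_eigenvalue :: "real \<Rightarrow> real \<Rightarrow> real \<Rightarrow> real \<Rightarrow> nat \<Rightarrow> real" where
  "dunkl_eigenvalue r1 r2 \<rho>1 \<rho>2 n =
     (if even n then real n / 2 else r1 + r2 - \<rho>1 - \<rho>2 - (real n + 1) / 2)"

text \<open>
  Existence and uniqueness rely on the eigenvalues being pairwise distinct, which holds if
  \<open>r1 + r2 - \<rho>1 - \<rho>2\<close> is not a positive integer.
\<close>

definition bannai_ito :: "real \<Rightarrow> real \<Rightarrow> real \<Rightarrow> real \<Rightarrow> nat \<Rightarrow> complex poly" where
  "bannai_ito r1 r2 \<rho>1 \<rho>2 n =
     (THE p. degree p = n \<and> lead_coeff p = 1 \<and>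
        dunkl_shift r1 r2 \<rho>1 \<rho>2 p = smult (of_real (dunkl_eigenvalue r1 r2 \<rho>1 \<rho>2 n)) p)"

definition hypergeom_3F2 ::
    "complex \<Rightarrow> complex \<Rightarrow> complex \<Rightarrow> complex \<Rightarrow> complex \<Rightarrow> complex \<Rightarrow> complex" where
  "hypergeom_3F2 a1 a2 a3 b1 b2 z =
     (\<Sum>k. pochhammer a1 k * pochhammer a2 k * pochhammer a3 k
            / (pochhammer b1 k * pochhammer b2 k) * z ^ k / fact k)"

text \<open>
  The argument \<open>t\<close> stands for \<open>x\<^sup>2\<close>; the choice of square root is immaterial because the
  defining expression is even in \<open>x\<close>.
\<close>

definition cont_dual_hahn :: "nat \<Rightarrow> complex \<Rightarrow> complex \<Rightarrow> complex \<Rightarrow> complex \<Rightarrow> complex" where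
  "cont_dual_hahn n t a b c =
     hypergeom_3F2 (- of_nat n) (a + \<i> * csqrt t) (a - \<i> * csqrt t) (a + b) (a + c) 1"

lemma cont_dual_hahn_power2:
  "cont_dual_hahn n (x\<^sup>2) a b c =
     hypergeom_3F2 (- of_nat n) (a + \<i> * x) (a - \<i> * x) (a + b) (a + c) 1"
proof -
  have "csqrt (x\<^sup>2) = x \<or> csqrt (x\<^sup>2) = - x"
    using power2_eq_iff power2_csqrt by blast
  then show ?thesis
    by (auto simp: cont_dual_hahn_def hypergeom_3F2_def mult_ac)
qed

end

theory Submission
  imports Defs "HOL-Complex_Analysis.Complex_Analysis" "HOL-Probability.Sinc_Integral"
begin

text \<open>
  Put \<open>x = z/2 - 1/4\<close> with \<open>z = 2 \<i> y\<close>. The reflections \<open>x \<mapsto> -x\<close> and \<open>x \<mapsto> -x - 1\<close> become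
  \<open>z \<mapsto> 1 - z\<close> and \<open>z \<mapsto> -1 - z\<close>, and under the hypothesis on \<open>\<rho>1\<close>, \<open>\<rho>2\<close> their coefficients become
  \<open>(z - a)(z - b) / (4 (z - 1/2))\<close> and \<open>(z + a)(z + b) / (4 (z + 1/2))\<close>. The map \<open>z \<mapsto> -z\<close> exchanges the
  two terms of the operator, so even and odd functions can be treated separately. On the even functions
  \<open>\<phi>\<^sub>k(z) = (a + z)\<^sub>k (a - z)\<^sub>k\<close>, and likewise on the odd functions \<open>z \<phi>\<^sub>k(z)\<close>, the operator is bidiagonal
  (\<open>dunkl_shift_hahn_basis\<close>, \<open>dunkl_shift_times_hahn_basis\<close>). Solving the resulting two-term recursion
  for the coefficients of an eigenfunction gives exactly the two \<open>\<^sub>3F\<^sub>2\<close> sums.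

  Two contiguous relations between these sums (\<open>hahn_sum_step_even\<close>, \<open>hahn_sum_step_odd\<close>) say that, read
  in alternation, they satisfy the three-term recurrence with the numbers \<open>u n\<close>. The family defined by
  the recurrence is visibly monic of the right degree, so it consists of monic eigenfunctions; as the
  eigenvalues are distinct, it is the Bannai-Ito family (\<open>bannai_ito_eq_monic_ops\<close>).

  By the recurrence, orthogonality reduces to the single statement that \<open>\<integral> w S\<^sub>n = 0\<close> for \<open>n \<ge> 1\<close>
  (\<open>monic_ops_orthogonal\<close>). For odd \<open>n\<close> this is parity. For even \<open>n\<close>, multiplication by \<open>\<phi>\<^sub>k\<close> turns the
  weight with parameters \<open>(a, b)\<close> into the weight with parameters \<open>(a + k, b)\<close>, and the total mass of the
  latter is \<open>(a)\<^sub>k (a + b)\<^sub>k\<close> times that of the former (\<open>integral_dual_hahn_weight_moment\<close>). These factors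
  cancel the denominators of the \<open>\<^sub>3F\<^sub>2\<close> and leave \<open>\<Sum>\<^sub>k (-1)\<^sup>k (n choose k) = 0\<close>.

  The ratio of total masses comes from a shift of the line of integration. The reflection formula
  for \<open>\<Gamma>(1/2 + z)\<close> makes the weight a product of four Gamma functions and \<open>cos (\<pi> z)\<close>, and a
  first-order difference of a product of this kind is \<open>2 (a b + z\<^sup>2)\<close> times the weight, so its integral vanishes
  once the line is moved by one. Both the shift and integrability rest on
  \<open>\<bar>\<Gamma>(s + \<i> t)\<bar> = O(e\<^bsup>-|t|\<^esup>)\<close>, locally uniformly in \<open>s > 0\<close>: four such factors beat \<open>\<bar>cos (\<pi> z)\<bar> \<le> e\<^bsup>\<pi>|t|\<^esup>\<close>
  because \<open>\<pi> < 4\<close>.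
\<close>

section \<open>Monic polynomials with a three-term recurrence\<close>

fun monic_ops :: "(nat \<Rightarrow> complex) \<Rightarrow> nat \<Rightarrow> complex poly" where
  "monic_ops u 0 = 1"
| "monic_ops u (Suc 0) = [:0, 1:]"
| "monic_ops u (Suc (Suc n)) = [:0, 1:] * monic_ops u (Suc n) - smult (u (Suc n)) (monic_ops u n)"

lemma degree_monic_ops: "degree (monic_ops u n) = n \<and> lead_coeff (monic_ops u n) = 1"
proof (induction u n rule: monic_ops.induct)
  case (3 u n)
  let ?p = "[:0, 1:] * monic_ops u (Suc n)"
  have p: "degree ?p = Suc (Suc n)" "lead_coeff ?p = 1"
    using 3(1) by (auto simp: degree_pCons_eq)
  have q: "degree (smult (u (Suc n)) (monic_ops u n)) < degree ?p"
    using 3(2) p(1) degree_smult_le[of "u (Suc n)" "monic_ops u n"] by linarith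
  have "degree (?p - smult (u (Suc n)) (monic_ops u n)) = degree ?p"
    using degree_add_eq_left[of "- smult (u (Suc n)) (monic_ops u n)" ?p] q by (simp only: degree_minus diff_conv_add_uminus)
  moreover have "coeff (smult (u (Suc n)) (monic_ops u n)) (degree ?p) = 0"
    using q by (rule coeff_eq_0)
  ultimately show ?case using p by (simp only: monic_ops.simps coeff_diff) simp
qed auto

text \<open>
  Expanding the polynomial of smaller degree by the recurrence moves a factor \<open>x\<close> to the other one, where the
  recurrence changes the degree by at most one; so the gap between the degrees never closes before
  the smaller polynomial has become constant. A functional that kills every member but the first
  therefore kills all mixed products.
\<close>
lemma monic_ops_orthogonal:
  fixes \<Lambda> :: "complex poly \<Rightarrow> complex"
  assumes add: "\<And>p q. \<Lambda> (p + q) = \<Lambda> p + \<Lambda> q" and smult: "\<And>c p. \<Lambda> (smult c p) = c * \<Lambda> p"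
    and zero: "\<And>n. n \<ge> 1 \<Longrightarrow> \<Lambda> (monic_ops u n) = 0"
    and "m < n"
  shows "\<Lambda> (monic_ops u m * monic_ops u n) = 0"
  using \<open>m < n\<close>
proof (induction m arbitrary: n rule: less_induct)
  case (less m)
  obtain l where n: "n = Suc l" using less.prems by (cases n) auto
  have x_times: "[:0, 1:] * monic_ops u n = monic_ops u (Suc n) + smult (u n) (monic_ops u l)"
    by (simp add: n)
  consider "m = 0" | "m = 1" | k where "m = Suc (Suc k)"
    by (metis One_nat_def not0_implies_Suc)
  then show ?case
  proof cases
    case 1
    then show ?thesis using zero[of n] less.prems by simp
  next
    case 2
    then have "monic_ops u m * monic_ops u n = [:0, 1:] * monic_ops u n" by simp
    moreover have "l \<ge> 1" using less.prems n 2 by simp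
    ultimately show ?thesis using zero[of "Suc n"] zero[of l] by (simp add: x_times add smult del: mult_pCons_left)
  next
    case (3 k)
    have "monic_ops u m * monic_ops u n = monic_ops u (Suc k) * ([:0, 1:] * monic_ops u n) + smult (- u (Suc k)) (monic_ops u k * monic_ops u n)"
      by (simp add: 3 algebra_simps)
    also have "\<dots> = monic_ops u (Suc k) * monic_ops u (Suc n) + (smult (u n) (monic_ops u (Suc k) * monic_ops u l)
        + smult (- u (Suc k)) (monic_ops u k * monic_ops u n))"
      by (simp only: x_times) (simp add: algebra_simps)
    finally show ?thesis
      using less.IH[of "Suc k" "Suc n"] less.IH[of "Suc k" l] less.IH[of k n] less.prems 3 n
      by (simp only: add smult) simp
  qed
qed

section \<open>Hypergeometric expansion\<close>

text \<open>
  The factor \<open>(-1/4)\<^sup>n (c)\<^sub>n (d)\<^sub>n\<close> makes \<open>hahn_sum a c d n (2 \<i> y)\<close> monic of degree \<open>2 n\<close> in \<open>y\<close>. The values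
  in use are \<open>d = a + b\<close>, with \<open>c = a\<close> for the polynomials of even degree and \<open>c = a + 1\<close> for those
  of odd degree; the basis keeps the parameter \<open>a\<close> in both cases.
\<close>
definition hahn_coeff :: "complex \<Rightarrow> complex \<Rightarrow> nat \<Rightarrow> nat \<Rightarrow> complex" where
  "hahn_coeff c d n k = (- 1/4) ^ n * pochhammer c n * pochhammer d n * pochhammer (- of_nat n) k
     / (pochhammer c k * pochhammer d k * fact k)"

definition hahn_basis :: "complex \<Rightarrow> nat \<Rightarrow> complex \<Rightarrow> complex" where
  "hahn_basis a k z = pochhammer (a + z) k * pochhammer (a - z) k"

definition hahn_sum :: "complex \<Rightarrow> complex \<Rightarrow> complex \<Rightarrow> nat \<Rightarrow> complex \<Rightarrow> complex" where
  "hahn_sum a c d n z = (\<Sum>k\<le>n. hahn_coeff c d n k * hahn_basis a k z)"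

lemma hahn_coeff_eq_0: "n < k \<Longrightarrow> hahn_coeff c d n k = 0"
  by (simp add: hahn_coeff_def pochhammer_of_nat_eq_0_lemma)

lemma hahn_sum_extend: "hahn_sum a c d n z = (\<Sum>k\<le>Suc n. hahn_coeff c d n k * hahn_basis a k z)"
  by (simp add: hahn_sum_def hahn_coeff_eq_0)

lemma hahn_sum_hypergeom:
  "hahn_sum a c d n z = (- 1/4) ^ n * (pochhammer c n * pochhammer d n)
     * hypergeom_3F2 (- of_nat n) (a + z) (a - z) c d 1"
proof -
  have "hypergeom_3F2 (- of_nat n) (a + z) (a - z) c d 1 =
     (\<Sum>k\<le>n. pochhammer (- of_nat n) k * pochhammer (a + z) k * pochhammer (a - z) k
            / (pochhammer c k * pochhammer d k) * 1 ^ k / fact k)"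
    unfolding hypergeom_3F2_def
    by (rule suminf_finite) (auto simp: pochhammer_of_nat_eq_0_lemma)
  then show ?thesis
    by (simp add: hahn_sum_def hahn_coeff_def hahn_basis_def sum_distrib_left mult_ac)
qed

lemma hahn_basis_Suc: "hahn_basis a (Suc k) z = ((a + of_nat k)\<^sup>2 - z\<^sup>2) * hahn_basis a k z"
  by (simp add: hahn_basis_def pochhammer_Suc power2_eq_square algebra_simps)

text \<open>
  Lowering \<open>c\<close> from \<open>a + 1\<close> to \<open>a\<close> changes the coefficient of \<open>\<phi>\<^sub>k\<close> only by a factor proportional to \<open>a + k\<close>, and
  lowering \<open>n\<close> by one produces a factor proportional to \<open>n - k\<close>; a suitable combination of the latter with
  the constant \<open>a + n\<close> gives \<open>a + k\<close>.
\<close>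
lemma hahn_coeff_step_even:
  assumes "\<And>k::nat. a + of_nat k \<noteq> 0"
  shows "hahn_coeff (a + 1) d (Suc n) k + of_nat (Suc n) * (of_nat n + d) / 4 * hahn_coeff (a + 1) d n k
       = hahn_coeff a d (Suc n) k"
proof -
  define D where "D = pochhammer d k * fact k"
  define M where "M = pochhammer (- of_nat (Suc n) :: complex) k"
  define P where "P = pochhammer (a + 1) n"
  define Q where "Q = pochhammer d n"
  define R where "R = pochhammer (a + 1) k"
  have a: "a \<noteq> 0" "a + of_nat k \<noteq> 0" using assms[of 0] assms[of k] by simp_all
  have R_eq: "R = pochhammer a k * (a + of_nat k) / a"
    using pochhammer_Suc[of a k] pochhammer_rec[of a k] a by (simp add: R_def field_simps)
  have M_eq: "of_nat (Suc n) * pochhammer (- of_nat n) k = (of_nat (Suc n) - of_nat k) * M"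
    using pochhammer_absorb_comp[of "of_nat (Suc n) :: complex" k] by (simp add: M_def algebra_simps)
  define T where "T = (- 1/4) ^ Suc n * P * Q * (of_nat n + d) * M / (R * D)"
  have "of_nat (Suc n) * (of_nat n + d) / 4 * hahn_coeff (a + 1) d n k
      = (of_nat n + d) / 4 * (- 1/4) ^ n * P * Q * (of_nat (Suc n) * pochhammer (- of_nat n) k) / (R * D)"
    by (simp add: hahn_coeff_def P_def Q_def R_def D_def mult_ac)
  also have "\<dots> = - (T * (of_nat (Suc n) - of_nat k))"
    unfolding M_eq T_def by simp
  finally have low: "of_nat (Suc n) * (of_nat n + d) / 4 * hahn_coeff (a + 1) d n k = - (T * (of_nat (Suc n) - of_nat k))" .
  have high: "hahn_coeff (a + 1) d (Suc n) k = T * (a + 1 + of_nat n)"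
    by (simp add: hahn_coeff_def T_def P_def Q_def R_def D_def M_def pochhammer_Suc mult_ac add_ac)
  have "hahn_coeff (a + 1) d (Suc n) k + of_nat (Suc n) * (of_nat n + d) / 4 * hahn_coeff (a + 1) d n k = T * (a + of_nat k)"
    unfolding low high by (simp add: algebra_simps)
  also have "\<dots> = (- 1/4) ^ Suc n * P * Q * (of_nat n + d) * M * a / (pochhammer a k * D)"
    unfolding T_def R_eq using a by simp
  also have "\<dots> = hahn_coeff a d (Suc n) k"
    unfolding hahn_coeff_def pochhammer_rec[of a n] pochhammer_Suc[of d n]
    by (simp add: P_def Q_def M_def D_def mult_ac add_ac)
  finally show ?thesis .
qed

text \<open>
  Here multiplication by \<open>z\<^sup>2\<close> raises the index of the basis. All four coefficients are rational
  multiples of the first one, so the claim is an identity between polynomials in \<open>n\<close>, \<open>j\<close>, \<open>a\<close>, \<open>b\<close>.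
\<close>
lemma hahn_coeff_step_odd:
  fixes a b :: complex
  assumes "\<And>k::nat. a + of_nat k \<noteq> 0" "\<And>k::nat. a + b + of_nat k \<noteq> 0"
  shows "hahn_coeff (a + 1) (a + b) n j - (a + of_nat (Suc j))\<^sup>2 * hahn_coeff (a + 1) (a + b) n (Suc j)
     = 4 * hahn_coeff a (a + b) (Suc n) (Suc j) + (of_nat n + a) * (of_nat n + b) * hahn_coeff a (a + b) n (Suc j)"
proof -
  define A where "A = a + b"
  define N J :: complex where "N = of_nat n" and "J = of_nat j"
  have nz: "a \<noteq> 0" "a + 1 + J \<noteq> 0" "A + J \<noteq> 0" "1 + J \<noteq> 0"
    using assms(1)[of 0] assms(1)[of "Suc j"] assms(2)[of j] of_nat_neq_0[of j, where 'a = complex] by (simp_all add: A_def J_def add_ac)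
  define K where "K = hahn_coeff (a + 1) A n j"
  define c where "c = (- 1/4) ^ n * pochhammer A n * pochhammer (- N) j / (pochhammer A j * fact j)"
  have K: "K = c * pochhammer (a + 1) n / pochhammer (a + 1) j"
    by (simp add: K_def hahn_coeff_def c_def N_def mult_ac)
  have 1: "hahn_coeff (a + 1) A n (Suc j) = K * (J - N) / ((a + 1 + J) * (A + J) * (1 + J))"
    by (simp add: K c_def N_def J_def hahn_coeff_def pochhammer_Suc mult_ac add_ac)
  have an: "(N + a) * pochhammer a n = a * pochhammer (a + 1) n"
    using pochhammer_Suc[of a n] pochhammer_rec[of a n] by (simp add: N_def mult_ac add_ac)
  have 2: "4 * hahn_coeff a A (Suc n) (Suc j) = K * (A + N) * (N + 1) / ((A + J) * (1 + J))"
  proof -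
    define q where "q = N + 1"
    have "pochhammer (- of_nat (Suc n) :: complex) (Suc j) = - (q * pochhammer (- N) j)"
      by (subst pochhammer_rec) (simp add: N_def q_def algebra_simps)
    then have "4 * hahn_coeff a A (Suc n) (Suc j) = 4 * ((- 1/4) ^ Suc n * (a * pochhammer (a + 1) n) * (pochhammer A n * (A + N)) * (- (q * pochhammer (- N) j))
       / ((a * pochhammer (a + 1) j) * (pochhammer A j * (A + J)) * (fact j * (1 + J))))"
      by (simp only: hahn_coeff_def pochhammer_rec[of a] pochhammer_Suc[of A] N_def J_def fact_Suc of_nat_mult of_nat_Suc mult.commute[of _ "fact j"])
    also have "\<dots> = K * (A + N) * q / ((A + J) * (1 + J))"
      using nz by (simp add: K c_def mult_ac)
    finally show ?thesis unfolding q_def .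
  qed
  have 3: "(N + a) * (N + b) * hahn_coeff a A n (Suc j) = K * (N + b) * (J - N) / ((A + J) * (1 + J))"
  proof -
    have "hahn_coeff a A n (Suc j) = ((- 1/4) ^ n * pochhammer a n * pochhammer A n * (pochhammer (- N) j * (J - N))
       / ((a * pochhammer (a + 1) j) * (pochhammer A j * (A + J)) * (fact j * (1 + J))))"
      by (simp add: hahn_coeff_def pochhammer_rec[of a] pochhammer_Suc[of A] pochhammer_Suc[of "- of_nat n"] N_def J_def mult_ac)
    then have "(N + a) * (N + b) * hahn_coeff a A n (Suc j) = (N + b) * ((- 1/4) ^ n * ((N + a) * pochhammer a n) * pochhammer A n * (pochhammer (- N) j * (J - N))
       / ((a * pochhammer (a + 1) j) * (pochhammer A j * (A + J)) * (fact j * (1 + J))))"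
      by simp
    also have "\<dots> = K * (N + b) * (J - N) / ((A + J) * (1 + J))"
      unfolding an using nz by (simp add: K c_def mult_ac)
    finally show ?thesis .
  qed
  have "K - (a + 1 + J)\<^sup>2 * (K * (J - N) / ((a + 1 + J) * (A + J) * (1 + J)))
      = K * ((A + J) * (1 + J) - (a + 1 + J) * (J - N)) / ((A + J) * (1 + J))"
    using nz by (simp add: divide_simps power2_eq_square) (simp add: algebra_simps)
  also have "(A + J) * (1 + J) - (a + 1 + J) * (J - N) = (A + N) * (N + 1) + (N + b) * (J - N)"
    by (simp add: A_def algebra_simps)
  finally have "K - (a + 1 + J)\<^sup>2 * (K * (J - N) / ((a + 1 + J) * (A + J) * (1 + J)))
      = K * ((A + N) * (N + 1) + (N + b) * (J - N)) / ((A + J) * (1 + J))" .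
  then have "K - (a + 1 + J)\<^sup>2 * hahn_coeff (a + 1) A n (Suc j)
     = 4 * hahn_coeff a A (Suc n) (Suc j) + (N + a) * (N + b) * hahn_coeff a A n (Suc j)"
    unfolding 1 2 3 by (simp only: distrib_left[of K "(A + N) * (N + 1)" "(N + b) * (J - N)"] add_divide_distrib mult.assoc)
  then show ?thesis
    by (simp add: K_def A_def N_def J_def add_ac)
qed

lemma hahn_coeff_step_odd_0:
  "- (a\<^sup>2) * hahn_coeff (a + 1) (a + b) n 0
     = 4 * hahn_coeff a (a + b) (Suc n) 0 + (of_nat n + a) * (of_nat n + b) * hahn_coeff a (a + b) n 0"
proof -
  have an: "(of_nat n + a) * pochhammer a n = a * pochhammer (a + 1) n"
    using pochhammer_Suc[of a n] pochhammer_rec[of a n] by (simp add: mult_ac add_ac)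
  have "(of_nat n + a) * (of_nat n + b) * hahn_coeff a (a + b) n 0
      = (of_nat n + b) * (- 1/4) ^ n * ((of_nat n + a) * pochhammer a n) * pochhammer (a + b) n"
    by (simp add: hahn_coeff_def)
  then show ?thesis
    unfolding an by (simp add: hahn_coeff_def pochhammer_rec[of a n] pochhammer_Suc[of "a + b" n] power2_eq_square algebra_simps)
qed

lemma hahn_sum_step_even:
  assumes "\<And>k::nat. a + of_nat k \<noteq> 0"
  shows "hahn_sum a (a + 1) d (Suc n) z + of_nat (Suc n) * (of_nat n + d) / 4 * hahn_sum a (a + 1) d n z
       = hahn_sum a a d (Suc n) z"
  unfolding hahn_sum_extend[of _ _ _ n] hahn_sum_def[of _ _ _ "Suc n"] sum_distrib_left sum.distrib[symmetric]
    hahn_coeff_step_even[OF assms, symmetric]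
  by (simp only: distrib_right mult.assoc)

lemma hahn_sum_step_odd:
  assumes "\<And>k::nat. a + of_nat k \<noteq> 0" "\<And>k::nat. a + b + of_nat k \<noteq> 0"
  shows "- (z\<^sup>2) * hahn_sum a (a + 1) (a + b) n z
       = 4 * hahn_sum a a (a + b) (Suc n) z + (of_nat n + a) * (of_nat n + b) * hahn_sum a a (a + b) n z"
proof -
  let ?o = "hahn_coeff (a + 1) (a + b) n" and ?\<phi> = "\<lambda>k. hahn_basis a k z"
  have "- (z\<^sup>2) * hahn_sum a (a + 1) (a + b) n z = (\<Sum>k\<le>n. ?o k * ?\<phi> (Suc k)) - (\<Sum>k\<le>n. (a + of_nat k)\<^sup>2 * ?o k * ?\<phi> k)"
    by (simp add: hahn_sum_def sum_distrib_left hahn_basis_Suc algebra_simps flip: sum_subtractf)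
  also have "(\<Sum>k\<le>n. (a + of_nat k)\<^sup>2 * ?o k * ?\<phi> k) = (\<Sum>k\<le>Suc n. (a + of_nat k)\<^sup>2 * ?o k * ?\<phi> k)"
    by (simp add: hahn_coeff_eq_0)
  also have "\<dots> = a\<^sup>2 * ?o 0 * ?\<phi> 0 + (\<Sum>k\<le>n. (a + of_nat (Suc k))\<^sup>2 * ?o (Suc k) * ?\<phi> (Suc k))"
    by (subst sum.atMost_Suc_shift) simp
  finally have "- (z\<^sup>2) * hahn_sum a (a + 1) (a + b) n z =
      (- (a\<^sup>2) * ?o 0) * ?\<phi> 0 + (\<Sum>k\<le>n. (?o k - (a + of_nat (Suc k))\<^sup>2 * ?o (Suc k)) * ?\<phi> (Suc k))"
    by (simp add: sum_subtractf left_diff_distrib)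
  also have "\<dots> = (\<Sum>k\<le>Suc n. (4 * hahn_coeff a (a + b) (Suc n) k + (of_nat n + a) * (of_nat n + b) * hahn_coeff a (a + b) n k) * ?\<phi> k)"
    unfolding hahn_coeff_step_odd[OF assms] hahn_coeff_step_odd_0 by (subst sum.atMost_Suc_shift) simp
  also have "\<dots> = 4 * hahn_sum a a (a + b) (Suc n) z + (of_nat n + a) * (of_nat n + b) * hahn_sum a a (a + b) n z"
    unfolding hahn_sum_extend[of _ _ _ n] hahn_sum_def[of _ _ _ "Suc n"] sum_distrib_left sum.distrib[symmetric]
    by (simp only: distrib_right mult.assoc)
  finally show ?thesis .
qed

lemma hahn_sum_0: "hahn_sum a c d 0 z = 1"
  by (simp add: hahn_sum_def hahn_coeff_def hahn_basis_def)

lemma poly_monic_ops_hahn: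
  assumes "\<And>k::nat. a + of_nat k \<noteq> 0" "\<And>k::nat. a + b + of_nat k \<noteq> 0"
    and u_even: "\<And>n. u (2 * n) = of_nat n * (of_nat n + a + b - 1) / 4"
    and u_odd: "\<And>n. u (2 * n + 1) = (of_nat n + a) * (of_nat n + b) / 4"
  shows "poly (monic_ops u (2 * n)) y = hahn_sum a a (a + b) n (2 * \<i> * y)"
    and "poly (monic_ops u (2 * n + 1)) y = y * hahn_sum a (a + 1) (a + b) n (2 * \<i> * y)"
proof (induction n)
  case 0
  { case 1 show ?case by (simp add: hahn_sum_0) }
  { case 2 show ?case by (simp add: hahn_sum_0) }
next
  case (Suc n)
  let ?z = "2 * \<i> * y"
  have even: "poly (monic_ops u (2 * Suc n)) y = hahn_sum a a (a + b) (Suc n) ?z"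
  proof -
    have "poly (monic_ops u (2 * Suc n)) y = y * poly (monic_ops u (2 * n + 1)) y - u (2 * n + 1) * poly (monic_ops u (2 * n)) y"
      by simp
    also have "\<dots> = - (?z\<^sup>2) * hahn_sum a (a + 1) (a + b) n ?z / 4 - (of_nat n + a) * (of_nat n + b) / 4 * hahn_sum a a (a + b) n ?z"
      unfolding Suc u_odd by (simp add: power_mult_distrib) (simp add: power2_eq_square)
    also have "\<dots> = hahn_sum a a (a + b) (Suc n) ?z"
      unfolding hahn_sum_step_odd[OF assms(1,2)] by (simp add: field_simps)
    finally show ?thesis .
  qed
  { case 1 show ?case by (rule even) }
  { case 2
    have "poly (monic_ops u (2 * Suc n + 1)) y = y * poly (monic_ops u (2 * Suc n)) y - u (2 * Suc n) * poly (monic_ops u (2 * n + 1)) y"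
      by simp
    also have "\<dots> = y * (hahn_sum a a (a + b) (Suc n) ?z - of_nat (Suc n) * (of_nat n + (a + b)) / 4 * hahn_sum a (a + 1) (a + b) n ?z)"
      unfolding even Suc u_even by (simp add: algebra_simps)
    also have "\<dots> = y * hahn_sum a (a + 1) (a + b) (Suc n) ?z"
      unfolding hahn_sum_step_even[OF assms(1), symmetric] by (simp add: algebra_simps)
    finally show ?case . }
qed

section \<open>The Dunkl shift operator and its eigenfunctions\<close>

text \<open>
  The Dunkl shift operator for \<open>\<rho>1 + \<rho>2 = - r1 - r2\<close> and \<open>\<rho>1 \<rho>2 = r1 r2\<close>, in the variable \<open>z = 2 x + 1/2\<close>;
  \<open>poly_dunkl_shift_affine\<close> makes the translation.
\<close>
definition dunkl_shift_fun :: "complex \<Rightarrow> complex \<Rightarrow> (complex \<Rightarrow> complex) \<Rightarrow> complex \<Rightarrow> complex" where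
  "dunkl_shift_fun a b f z = (z - a) * (z - b) / (4 * (z - 1/2)) * (f z - f (1 - z))
     + (z + a) * (z + b) / (4 * (z + 1/2)) * (f (- 1 - z) - f z)"

lemma dunkl_shift_fun_sum:
  "dunkl_shift_fun a b (\<lambda>z. \<Sum>k\<in>I. c k * f k z) z = (\<Sum>k\<in>I. c k * dunkl_shift_fun a b (f k) z)"
  unfolding dunkl_shift_fun_def sum_subtractf[symmetric] sum_distrib_left sum.distrib[symmetric]
  by (intro sum.cong refl) (simp add: algebra_simps)

text \<open>
  The factors \<open>z - a\<close> and \<open>z + a\<close> come from the coefficients of the operator; they supply the factor missing
  from the shifted Pochhammer symbols, so no division is needed.
\<close>
lemma hahn_basis_reflect:
  "(z - a) * hahn_basis a (Suc j) (1 - z)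
     = - ((a - z + of_nat j) * (a + 1 - z + of_nat j) * (a + z - 1) * hahn_basis a j z)"
  "(z + a) * hahn_basis a (Suc j) (- 1 - z)
     = (a + z + of_nat j) * (a + 1 + z + of_nat j) * (a - z - 1) * hahn_basis a j z"
proof -
  have V: "(a - z) * pochhammer (a - z + 1) j = pochhammer (a - z) j * (a - z + of_nat j)"
    and U: "(a + z) * pochhammer (a + z + 1) j = pochhammer (a + z) j * (a + z + of_nat j)"
    by (simp_all only: pochhammer_rec[symmetric] pochhammer_Suc)
  have eqs: "a + (1 - z) = a - z + 1" "a - (1 - z) = a + z - 1" "a + (- 1 - z) = a - z - 1"
    "a - (- 1 - z) = a + z + 1" "a + z - 1 + 1 = a + z" "a - z - 1 + 1 = a - z"
    by simp_all
  have "pochhammer (a + (1 - z)) (Suc j) = pochhammer (a - z + 1) j * (a - z + 1 + of_nat j)"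
    "pochhammer (a - (1 - z)) (Suc j) = (a + z - 1) * pochhammer (a + z) j"
    by (simp_all only: eqs pochhammer_Suc[of "a - z + 1"] pochhammer_rec[of "a + z - 1"])
  then have "(z - a) * hahn_basis a (Suc j) (1 - z)
    = - (((a - z) * pochhammer (a - z + 1) j) * (a - z + 1 + of_nat j) * (a + z - 1) * pochhammer (a + z) j)"
    by (simp only: hahn_basis_def) (simp add: algebra_simps)
  then show "(z - a) * hahn_basis a (Suc j) (1 - z)
     = - ((a - z + of_nat j) * (a + 1 - z + of_nat j) * (a + z - 1) * hahn_basis a j z)"
    unfolding V hahn_basis_def by (simp add: algebra_simps)
  have "pochhammer (a + (- 1 - z)) (Suc j) = (a - z - 1) * pochhammer (a - z) j"
    "pochhammer (a - (- 1 - z)) (Suc j) = pochhammer (a + z + 1) j * (a + z + 1 + of_nat j)"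
    by (simp_all only: eqs pochhammer_Suc[of "a + z + 1"] pochhammer_rec[of "a - z - 1"])
  then have "(z + a) * hahn_basis a (Suc j) (- 1 - z)
    = ((a + z) * pochhammer (a + z + 1) j) * (a + z + 1 + of_nat j) * (a - z - 1) * pochhammer (a - z) j"
    by (simp only: hahn_basis_def) (simp add: algebra_simps)
  then show "(z + a) * hahn_basis a (Suc j) (- 1 - z)
     = (a + z + of_nat j) * (a + 1 + z + of_nat j) * (a - z - 1) * hahn_basis a j z"
    unfolding U hahn_basis_def by (simp add: algebra_simps)
qed

text \<open>
  Both reflection differences vanish where the denominators do; dividing this out once here turns every later
  evaluation of the operator into a polynomial identity.
\<close>
lemma dunkl_shift_fun_eq:
  assumes "z \<noteq> 1/2" "z \<noteq> - 1/2"
    and "(z - a) * (f z - f (1 - z)) = (2 * z - 1) * p"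
    and "(z + a) * (f (- 1 - z) - f z) = (2 * z + 1) * q"
  shows "2 * dunkl_shift_fun a b f z = (z - b) * p + (z + b) * q"
proof -
  have nz: "2 * z - 1 \<noteq> 0" "2 * z + 1 \<noteq> 0" using assms by (auto simp: field_simps add_eq_0_iff)
  have denom: "4 * (z - 1/2) = 2 * (2 * z - 1)" "4 * (z + 1/2) = 2 * (2 * z + 1)" by simp_all
  have cancel: "2 * (s * t / (2 * m) * w) = t * (s * w) / m" for s t m w :: complex
    by simp
  have "2 * dunkl_shift_fun a b f z = (z - b) * ((z - a) * (f z - f (1 - z))) / (2 * z - 1)
     + (z + b) * ((z + a) * (f (- 1 - z) - f z)) / (2 * z + 1)"
    unfolding dunkl_shift_fun_def denom distrib_left[where a = "2 :: complex" and b = "_ / _ * _"] cancel ..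
  also have "\<dots> = (z - b) * p + (z + b) * q"
    unfolding assms(3,4) using nz by simp
  finally show ?thesis .
qed

lemma dunkl_shift_hahn_basis:
  assumes "z \<noteq> 1/2" "z \<noteq> - 1/2"
  shows "dunkl_shift_fun a b (hahn_basis a k) z
    = of_nat k * (hahn_basis a k z - (a + of_nat k - 1) * (a + b + of_nat k - 1) * hahn_basis a (k - 1) z)"
proof (cases k)
  case 0
  then show ?thesis by (simp add: dunkl_shift_fun_def hahn_basis_def)
next
  case (Suc j)
  define J H :: complex where "J = of_nat j" and "H = hahn_basis a j z"
  have 0: "hahn_basis a (Suc j) z = (a + z + J) * (a - z + J) * H"
    by (simp add: hahn_basis_Suc H_def J_def power2_eq_square algebra_simps)
  have "2 * dunkl_shift_fun a b (hahn_basis a (Suc j)) z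
      = (z - b) * ((J + 1) * (a - z + J) * H) + (z + b) * (- ((J + 1) * (a + z + J) * H))"
    by (rule dunkl_shift_fun_eq[OF assms])
      (unfold right_diff_distrib hahn_basis_reflect 0, simp_all add: H_def J_def algebra_simps)
  also have "\<dots> = 2 * ((J + 1) * ((a + z + J) * (a - z + J) * H - (a + J) * (a + b + J) * H))"
    by (simp add: algebra_simps)
  finally have "dunkl_shift_fun a b (hahn_basis a (Suc j)) z = (J + 1) * ((a + z + J) * (a - z + J) * H - (a + J) * (a + b + J) * H)"
    by (simp only: mult_cancel_left) simp
  then show ?thesis
    unfolding Suc 0 by (simp add: H_def[symmetric] J_def[symmetric] add_ac)
qed

lemma dunkl_shift_times_hahn_basis:
  assumes "z \<noteq> 1/2" "z \<noteq> - 1/2"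
  shows "dunkl_shift_fun a b (\<lambda>z. z * hahn_basis a k z) z
    = - (a + b) * (z * hahn_basis a k z)
      - of_nat k * (z * (hahn_basis a k z - (a + 1 + of_nat k - 1) * (a + b + of_nat k - 1) * hahn_basis a (k - 1) z))"
proof (cases k)
  case 0
  have "2 * dunkl_shift_fun a b (\<lambda>z. z) z = (z - b) * (z - a) + (z + b) * (- (z + a))"
    by (rule dunkl_shift_fun_eq[OF assms]) (simp_all add: algebra_simps)
  also have "\<dots> = 2 * (- (a + b) * z)" by (simp add: algebra_simps)
  finally have "dunkl_shift_fun a b (\<lambda>z. z) z = - (a + b) * z" by (simp only: mult_cancel_left) simp
  then show ?thesis using 0 by (simp add: hahn_basis_def)
next
  case (Suc j)
  define J H :: complex where "J = of_nat j" and "H = hahn_basis a j z"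
  have 0: "hahn_basis a (Suc j) z = (a + z + J) * (a - z + J) * H"
    by (simp add: hahn_basis_Suc H_def J_def power2_eq_square algebra_simps)
  have "2 * dunkl_shift_fun a b (\<lambda>z. z * hahn_basis a (Suc j) z) z
      = (z - b) * ((a - z + J) * ((z - a) * (a + z + J) + (1 - z) * (J + 1)) * H)
       + (z + b) * ((a + z + J) * ((1 + z) * (J + 1) - (z + a) * (a - z + J)) * H)"
  proof (rule dunkl_shift_fun_eq[OF assms])
    have "(z - a) * (z * hahn_basis a (Suc j) z - (1 - z) * hahn_basis a (Suc j) (1 - z))
        = z * ((z - a) * hahn_basis a (Suc j) z) - (1 - z) * ((z - a) * hahn_basis a (Suc j) (1 - z))"
      by (simp add: algebra_simps)
    also have "\<dots> = (2 * z - 1) * ((a - z + J) * ((z - a) * (a + z + J) + (1 - z) * (J + 1)) * H)"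
      unfolding hahn_basis_reflect 0 by (simp add: H_def J_def algebra_simps)
    finally show "(z - a) * (z * hahn_basis a (Suc j) z - (1 - z) * hahn_basis a (Suc j) (1 - z))
        = (2 * z - 1) * ((a - z + J) * ((z - a) * (a + z + J) + (1 - z) * (J + 1)) * H)" .
    have "(z + a) * ((- 1 - z) * hahn_basis a (Suc j) (- 1 - z) - z * hahn_basis a (Suc j) z)
        = (- 1 - z) * ((z + a) * hahn_basis a (Suc j) (- 1 - z)) - z * ((z + a) * hahn_basis a (Suc j) z)"
      by (simp add: algebra_simps)
    also have "\<dots> = (2 * z + 1) * ((a + z + J) * ((1 + z) * (J + 1) - (z + a) * (a - z + J)) * H)"
      unfolding hahn_basis_reflect 0 by (simp add: H_def J_def algebra_simps)
    finally show "(z + a) * ((- 1 - z) * hahn_basis a (Suc j) (- 1 - z) - z * hahn_basis a (Suc j) z)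
        = (2 * z + 1) * ((a + z + J) * ((1 + z) * (J + 1) - (z + a) * (a - z + J)) * H)" .
  qed
  also have "\<dots> = 2 * (- (a + b) * (z * ((a + z + J) * (a - z + J) * H))
      - (J + 1) * (z * ((a + z + J) * (a - z + J) * H - (a + 1 + J) * (a + b + J) * H)))"
    by (simp add: algebra_simps)
  finally have "dunkl_shift_fun a b (\<lambda>z. z * hahn_basis a (Suc j) z) z = - (a + b) * (z * ((a + z + J) * (a - z + J) * H))
      - (J + 1) * (z * ((a + z + J) * (a - z + J) * H - (a + 1 + J) * (a + b + J) * H))"
    by (simp only: mult_cancel_left) simp
  then show ?thesis
    unfolding Suc 0 by (simp add: H_def[symmetric] J_def[symmetric] add_ac)
qed

lemma hahn_coeff_Suc:
  assumes "\<And>k::nat. c + of_nat k \<noteq> 0" "\<And>k::nat. d + of_nat k \<noteq> 0"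
  shows "of_nat (Suc k) * (c + of_nat k) * (d + of_nat k) * hahn_coeff c d n (Suc k) = (of_nat k - of_nat n) * hahn_coeff c d n k"
proof -
  have nz: "c + of_nat k \<noteq> 0" "d + of_nat k \<noteq> 0" "of_nat (Suc k) \<noteq> (0 :: complex)"
    using assms of_nat_neq_0 by blast+
  have "hahn_coeff c d n (Suc k) = hahn_coeff c d n k * (of_nat k - of_nat n) / ((c + of_nat k) * (d + of_nat k) * of_nat (Suc k))"
    unfolding hahn_coeff_def pochhammer_Suc fact_Suc by (simp add: mult_ac del: of_nat_Suc)
  then show ?thesis using nz by (simp del: of_nat_Suc)
qed

text \<open>
  The operator sends the \<open>k\<close>-th basis function to a combination of itself and its predecessor. After
  the summation index of the lower terms is shifted, \<open>hahn_coeff_Suc\<close> replaces the diagonal factor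
  \<open>k\<close> by \<open>n\<close> in every term.
\<close>
lemma sum_hahn_coeff_lowering:
  assumes "\<And>k::nat. c + of_nat k \<noteq> 0" "\<And>k::nat. d + of_nat k \<noteq> 0"
  shows "(\<Sum>k\<le>n. hahn_coeff c d n k * (of_nat k * (f k - (c + of_nat k - 1) * (d + of_nat k - 1) * f (k - 1))))
    = of_nat n * (\<Sum>k\<le>n. hahn_coeff c d n k * f k)"
proof -
  let ?c = "hahn_coeff c d n"
  have "(\<Sum>k\<le>n. ?c k * (of_nat k * ((c + of_nat k - 1) * (d + of_nat k - 1) * f (k - 1))))
      = (\<Sum>k\<le>Suc n. ?c k * (of_nat k * ((c + of_nat k - 1) * (d + of_nat k - 1) * f (k - 1))))"
    by (simp add: hahn_coeff_eq_0)
  also have "\<dots> = (\<Sum>k\<le>n. of_nat (Suc k) * (c + of_nat k) * (d + of_nat k) * ?c (Suc k) * f k)"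
    by (subst sum.atMost_Suc_shift) (simp add: mult_ac)
  also have "\<dots> = (\<Sum>k\<le>n. (of_nat k - of_nat n) * ?c k * f k)"
    by (simp only: hahn_coeff_Suc[OF assms])
  finally have "(\<Sum>k\<le>n. ?c k * (of_nat k * f k)) - (\<Sum>k\<le>n. ?c k * (of_nat k * ((c + of_nat k - 1) * (d + of_nat k - 1) * f (k - 1))))
      = (\<Sum>k\<le>n. ?c k * (of_nat k * f k) - (of_nat k - of_nat n) * ?c k * f k)"
    by (simp add: sum_subtractf)
  also have "\<dots> = of_nat n * (\<Sum>k\<le>n. ?c k * f k)"
    unfolding sum_distrib_left by (intro sum.cong refl) (simp add: algebra_simps)
  finally show ?thesis
    by (simp add: right_diff_distrib sum_subtractf)
qed

lemma dunkl_shift_hahn_sum_even: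
  assumes "\<And>k::nat. a + of_nat k \<noteq> 0" "\<And>k::nat. a + b + of_nat k \<noteq> 0"
    and "z \<noteq> 1/2" "z \<noteq> - 1/2"
  shows "dunkl_shift_fun a b (hahn_sum a a (a + b) n) z = of_nat n * hahn_sum a a (a + b) n z"
proof -
  have "hahn_sum a a (a + b) n = (\<lambda>z. \<Sum>k\<le>n. hahn_coeff a (a + b) n k * hahn_basis a k z)"
    by (simp add: fun_eq_iff hahn_sum_def)
  then show ?thesis
    by (simp only: dunkl_shift_fun_sum dunkl_shift_hahn_basis[OF assms(3,4)] sum_hahn_coeff_lowering[OF assms(1,2), where f = "\<lambda>k. hahn_basis a k z"])
qed

lemma dunkl_shift_hahn_sum_odd:
  assumes "\<And>k::nat. a + of_nat k \<noteq> 0" "\<And>k::nat. a + b + of_nat k \<noteq> 0"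
    and "z \<noteq> 1/2" "z \<noteq> - 1/2"
  shows "dunkl_shift_fun a b (\<lambda>z. z * hahn_sum a (a + 1) (a + b) n z) z
     = - (a + b + of_nat n) * (z * hahn_sum a (a + 1) (a + b) n z)"
proof -
  let ?c = "hahn_coeff (a + 1) (a + b) n"
  have a1: "a + 1 + of_nat k \<noteq> 0" for k :: nat
    using assms(1)[of "Suc k"] by (simp add: add_ac)
  have "(\<lambda>z. z * hahn_sum a (a + 1) (a + b) n z) = (\<lambda>z. \<Sum>k\<le>n. ?c k * (z * hahn_basis a k z))"
    by (simp add: fun_eq_iff hahn_sum_def sum_distrib_left mult_ac)
  then have "dunkl_shift_fun a b (\<lambda>z. z * hahn_sum a (a + 1) (a + b) n z) z
     = - (a + b) * (z * (\<Sum>k\<le>n. ?c k * hahn_basis a k z))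
       - z * (\<Sum>k\<le>n. ?c k * (of_nat k * (hahn_basis a k z - (a + 1 + of_nat k - 1) * (a + b + of_nat k - 1) * hahn_basis a (k - 1) z)))"
    unfolding sum_distrib_left sum_subtractf[symmetric]
    by (simp only: dunkl_shift_fun_sum dunkl_shift_times_hahn_basis[OF assms(3,4)])
       (intro sum.cong refl, simp add: algebra_simps)
  also have "\<dots> = - (a + b + of_nat n) * (z * hahn_sum a (a + 1) (a + b) n z)"
    unfolding sum_hahn_coeff_lowering[OF a1 assms(2), where f = "\<lambda>k. hahn_basis a k z"] hahn_sum_def by (simp add: algebra_simps)
  finally show ?thesis .
qed

lemma poly_eqI_cofinite:
  fixes p q :: "complex poly"
  assumes "finite X" "\<And>x. x \<notin> X \<Longrightarrow> poly p x = poly q x"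
  shows "p = q"
proof -
  have "- X \<subseteq> {x. poly (p - q) x = 0}" using assms(2) by auto
  moreover have "infinite (- X)" using assms(1) infinite_UNIV_char_0 finite_compl by blast
  ultimately have "infinite {x. poly (p - q) x = 0}" using finite_subset by blast
  then show ?thesis using poly_roots_finite[of "p - q"] by auto
qed

text \<open>
  Linearity is read off from the pointwise formula, away from its two singular points, rather than from
  the two exact polynomial divisions.
\<close>
lemma dunkl_shift_linear:
  "dunkl_shift r1 r2 \<rho>1 \<rho>2 (smult c p + q) = smult c (dunkl_shift r1 r2 \<rho>1 \<rho>2 p) + dunkl_shift r1 r2 \<rho>1 \<rho>2 q"
proof (rule poly_eqI_cofinite[of "{0, - 1/2}"])
  fix x :: complex assume "x \<notin> {0, - 1/2}"
  then have "x \<noteq> 0" "x \<noteq> - 1/2" by auto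
  note at_x = poly_dunkl_shift[OF this, of r1 r2 \<rho>1 \<rho>2]
  define A where "A = (x - of_real \<rho>1) * (x - of_real \<rho>2) / (2 * x)"
  define B where "B = (x - of_real r1 + 1/2) * (x - of_real r2 + 1/2) / (2 * x + 1)"
  show "poly (dunkl_shift r1 r2 \<rho>1 \<rho>2 (smult c p + q)) x =
      poly (smult c (dunkl_shift r1 r2 \<rho>1 \<rho>2 p) + dunkl_shift r1 r2 \<rho>1 \<rho>2 q) x"
    unfolding poly_add poly_smult at_x A_def[symmetric] B_def[symmetric] by (simp add: algebra_simps)
qed simp

text \<open>
  The existence of monic eigenfunctions in all degrees already forces \<open>L\<close> to be triangular with diagonal
  entries \<open>\<mu> m\<close>: subtracting a multiple of \<open>P m\<close> lowers the degree. A difference of two monic eigenfunctions of degree \<open>n\<close> has smaller degree \<open>m\<close>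
  unless it vanishes, and its leading coefficient would give \<open>\<mu> m = \<mu> n\<close>.
\<close>
lemma monic_eigenpoly_unique:
  fixes L :: "complex poly \<Rightarrow> complex poly" and P :: "nat \<Rightarrow> complex poly"
  assumes lin: "\<And>c p q. L (smult c p + q) = smult c (L p) + L q"
    and P: "\<And>m. degree (P m) = m \<and> lead_coeff (P m) = 1 \<and> L (P m) = smult (\<mu> m) (P m)"
    and distinct: "\<And>m. m < n \<Longrightarrow> \<mu> m \<noteq> \<mu> n"
  shows "(THE p. degree p = n \<and> lead_coeff p = 1 \<and> L p = smult (\<mu> n) p) = P n"
proof (rule the_equality)
  have L0: "L 0 = 0" using lin[of "-1" 0 0] by simp
  have coeff_L: "degree f \<le> m \<Longrightarrow> degree (L f) \<le> m \<and> coeff (L f) m = \<mu> m * coeff f m" for f m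
  proof (induction m arbitrary: f rule: less_induct)
    case (less m)
    define g where "g = f - smult (coeff f m) (P m)"
    have f: "f = smult (coeff f m) (P m) + g" by (simp add: g_def)
    have cm: "coeff (P m) m = 1" and dP: "degree (P m) = m" using P[of m] by auto
    have dg: "degree g \<le> m"
      unfolding g_def using less.prems dP by (intro degree_diff_le order_trans[OF degree_smult_le]) auto
    have cg: "coeff g m = 0" by (simp add: g_def cm)
    have Lg: "degree (L g) \<le> m \<and> coeff (L g) m = 0"
    proof (cases "g = 0")
      case True
      then show ?thesis by (simp add: L0)
    next
      case False
      then have "degree g < m" using dg cg by (metis leading_coeff_0_iff le_neq_implies_less)
      from less.IH[OF this order_refl] this show ?thesis by (auto intro: coeff_eq_0)
    qed
    have "L f = smult (coeff f m * \<mu> m) (P m) + L g" by (subst f) (simp add: lin P)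
    then show ?case using Lg dP cm
      by (auto intro!: degree_add_le order_trans[OF degree_smult_le])
  qed
  show "degree (P n) = n \<and> lead_coeff (P n) = 1 \<and> L (P n) = smult (\<mu> n) (P n)" by (rule P)
  fix p assume p: "degree p = n \<and> lead_coeff p = 1 \<and> L p = smult (\<mu> n) p"
  define f where "f = p - P n"
  have "L f = smult (\<mu> n) f"
    using lin[of "-1" "P n" p] p P[of n] by (simp add: f_def smult_diff_right)
  moreover have "f = 0 \<or> degree f < n"
    using p P[of n] degree_diff_le[of p n "P n"] unfolding f_def
    by (metis coeff_diff diff_self le_neq_implies_less leading_coeff_0_iff order_refl)
  ultimately have "f = 0"
    using coeff_L[of f "degree f"] distinct[of "degree f"] by auto
  then show "p = P n" by (simp add: f_def)
qed

lemma poly_dunkl_shift_affine: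
  fixes a b :: real
  assumes \<rho>: "(\<rho>1 = - r1 \<and> \<rho>2 = - r2) \<or> (\<rho>1 = - r2 \<and> \<rho>2 = - r1)"
    and ab: "a = 1/2 - 2 * r1" "b = 1/2 - 2 * r2"
    and p: "\<And>x. poly p x = c * F (2 * x + 1/2)"
    and x: "x \<noteq> 0" "x \<noteq> - 1/2"
  shows "poly (dunkl_shift r1 r2 \<rho>1 \<rho>2 p) x = c * dunkl_shift_fun (of_real a) (of_real b) F (2 * x + 1/2)"
proof -
  define z where "z = 2 * x + 1/2"
  have args: "2 * (- x) + 1/2 = 1 - z" "2 * (- x - 1) + 1/2 = - 1 - z" by (simp_all add: z_def)
  have "(x - of_real \<rho>1) * (x - of_real \<rho>2) = (x + of_real r1) * (x + of_real r2)"
    using \<rho> by auto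
  also have "x + of_real r1 = (z - of_real a) / 2" by (simp add: z_def ab)
  also have "x + of_real r2 = (z - of_real b) / 2" by (simp add: z_def ab)
  finally have "(x - of_real \<rho>1) * (x - of_real \<rho>2) = (z - of_real a) / 2 * ((z - of_real b) / 2)" .
  moreover have "2 * x = z - 1/2" by (simp add: z_def)
  ultimately have A: "(x - of_real \<rho>1) * (x - of_real \<rho>2) / (2 * x) = (z - of_real a) * (z - of_real b) / (4 * (z - 1/2))"
    by (simp only:) simp
  have "x - of_real r1 + 1/2 = (z + of_real a) / 2" "x - of_real r2 + 1/2 = (z + of_real b) / 2" "2 * x + 1 = z + 1/2"
    by (simp_all add: z_def ab)
  then have B: "(x - of_real r1 + 1/2) * (x - of_real r2 + 1/2) / (2 * x + 1) = (z + of_real a) * (z + of_real b) / (4 * (z + 1/2))"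
    by (simp only:) simp
  show ?thesis
    unfolding poly_dunkl_shift[OF x] A B p args z_def[symmetric] dunkl_shift_fun_def
    by (simp only: distrib_left right_diff_distrib[of c, symmetric] mult.left_commute[of c])
qed

text \<open>
  The inner polynomial is the inverse of \<open>y \<mapsto> \<i> y - 1/4\<close>.
\<close>
lemma bannai_ito_eq_monic_ops:
  fixes r1 r2 \<rho>1 \<rho>2 a b :: real
  assumes r: "r1 < 1/4" "r2 < 1/4"
    and \<rho>: "(\<rho>1 = - r1 \<and> \<rho>2 = - r2) \<or> (\<rho>1 = - r2 \<and> \<rho>2 = - r1)"
    and ab: "a = 1/2 - 2 * r1" "b = 1/2 - 2 * r2"
    and u_even: "\<And>n. u (2 * n) = of_nat n * (of_nat n + of_real a + of_real b - 1) / 4"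
    and u_odd: "\<And>n. u (2 * n + 1) = (of_nat n + of_real a) * (of_nat n + of_real b) / 4"
  shows "bannai_ito r1 r2 \<rho>1 \<rho>2 n = smult (\<i> ^ n) (monic_ops u n \<circ>\<^sub>p [:- \<i> / 4, - \<i>:])"
proof -
  define P where "P = (\<lambda>m. smult (\<i> ^ m) (monic_ops u m \<circ>\<^sub>p [:- \<i> / 4, - \<i>:]))"
  define \<mu> where "\<mu> = (\<lambda>m. complex_of_real (dunkl_eigenvalue r1 r2 \<rho>1 \<rho>2 m))"
  have pos: "0 < a" "0 < b" using r ab by simp_all
  have a0: "complex_of_real a + of_nat k \<noteq> 0" for k :: nat
    using pos by (simp add: complex_eq_iff)
  have ab0: "complex_of_real a + of_real b + of_nat k \<noteq> 0" for k :: nat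
    using pos by (simp add: complex_eq_iff)
  have arg: "2 * \<i> * (- \<i> / 4 + x * - \<i>) = 2 * x + 1/2" for x :: complex
    by (simp add: algebra_simps)
  have even: "poly (P (2 * k)) x = \<i> ^ (2 * k) * hahn_sum (of_real a) (of_real a) (of_real a + of_real b) k (2 * x + 1/2)" for k x
    using poly_monic_ops_hahn(1)[of "of_real a" "of_real b" u k "- \<i> / 4 + x * - \<i>", OF a0 ab0 u_even u_odd]
    unfolding arg by (simp add: P_def poly_pcompose)
  have odd: "poly (P (2 * k + 1)) x = \<i> ^ (2 * k + 1) / (2 * \<i>) *
      ((2 * x + 1/2) * hahn_sum (of_real a) (of_real a + 1) (of_real a + of_real b) k (2 * x + 1/2))" for k x
  proof -
    have y: "- \<i> / 4 + x * - \<i> = (2 * x + 1/2) / (2 * \<i>)" by (simp add: field_simps)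
    have inner: "poly [:- \<i> / 4, - \<i>:] x = - \<i> / 4 + x * - \<i>" by simp
    have "poly (monic_ops u (2 * k + 1)) (- \<i> / 4 + x * - \<i>)
        = (2 * x + 1/2) / (2 * \<i>) * hahn_sum (of_real a) (of_real a + 1) (of_real a + of_real b) k (2 * x + 1/2)"
      using poly_monic_ops_hahn(2)[of "of_real a" "of_real b" u k "- \<i> / 4 + x * - \<i>", OF a0 ab0 u_even u_odd]
      unfolding arg y[symmetric] .
    then show ?thesis
      unfolding P_def poly_smult poly_pcompose inner
      by (simp only: times_divide_eq_left times_divide_eq_right mult.assoc)
  qed
  have eigen: "dunkl_shift r1 r2 \<rho>1 \<rho>2 (P m) = smult (\<mu> m) (P m)" for m
  proof (rule poly_eqI_cofinite[of "{0, - 1/2}"])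
    fix x :: complex assume "x \<notin> {0, - 1/2}"
    then have x: "x \<noteq> 0" "x \<noteq> - 1/2" by auto
    then have z: "2 * x + 1/2 \<noteq> 1/2" "2 * x + 1/2 \<noteq> - 1/2" by (auto simp: field_simps add_eq_0_iff)
    consider k where "m = 2 * k" | k where "m = 2 * k + 1" by (metis evenE oddE)
    then show "poly (dunkl_shift r1 r2 \<rho>1 \<rho>2 (P m)) x = poly (smult (\<mu> m) (P m)) x"
    proof cases
      case (1 k)
      have "\<mu> m = of_nat k" by (simp add: \<mu>_def dunkl_eigenvalue_def 1)
      then show ?thesis
        unfolding 1 poly_dunkl_shift_affine[OF \<rho> ab even x] poly_smult even dunkl_shift_hahn_sum_even[OF a0 ab0 z]
        by simp
    next
      case (2 k)
      have "r1 + r2 - \<rho>1 - \<rho>2 = 1 - a - b" using \<rho> ab by auto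
      then have "dunkl_eigenvalue r1 r2 \<rho>1 \<rho>2 m = - (a + b + real k)"
        by (simp add: dunkl_eigenvalue_def 2 field_simps)
      then have "\<mu> m = - (of_real a + of_real b + of_nat k)" by (simp add: \<mu>_def)
      then show ?thesis
        unfolding 2 poly_dunkl_shift_affine[OF \<rho> ab odd x] poly_smult odd dunkl_shift_hahn_sum_odd[OF a0 ab0 z]
        by simp
    qed
  qed simp
  have "degree (P m) = m \<and> lead_coeff (P m) = 1 \<and> dunkl_shift r1 r2 \<rho>1 \<rho>2 (P m) = smult (\<mu> m) (P m)" for m
  proof -
    have "\<i> ^ m * (- \<i>) ^ m = 1" by (simp flip: power_mult_distrib)
    moreover have "lead_coeff (monic_ops u m \<circ>\<^sub>p [:- \<i> / 4, - \<i>:]) = (- \<i>) ^ m"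
      using degree_monic_ops[of u m] by (subst lead_coeff_comp) auto
    moreover have "degree (monic_ops u m \<circ>\<^sub>p [:- \<i> / 4, - \<i>:]) = m"
      using degree_monic_ops[of u m] by (simp add: degree_pcompose)
    ultimately show ?thesis using eigen[of m] by (simp add: P_def)
  qed
  moreover have "\<mu> m \<noteq> \<mu> n" if "m < n" for m n
  proof -
    have "r1 + r2 - \<rho>1 - \<rho>2 < 1" using \<rho> r by auto
    moreover have "real k \<ge> 1" if "odd k" for k using that by (cases k) auto
    ultimately have "dunkl_eigenvalue r1 r2 \<rho>1 \<rho>2 m \<noteq> dunkl_eigenvalue r1 r2 \<rho>1 \<rho>2 n"
      using that by (cases "even m"; cases "even n") (force simp: dunkl_eigenvalue_def field_simps)+
    then show ?thesis by (simp add: \<mu>_def)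
  qed
  ultimately have "(THE p. degree p = n \<and> lead_coeff p = 1 \<and> dunkl_shift r1 r2 \<rho>1 \<rho>2 p = smult (\<mu> n) p) = P n"
    by (intro monic_eigenpoly_unique dunkl_shift_linear)
  then show ?thesis by (simp only: bannai_ito_def \<mu>_def P_def)
qed

section \<open>Exponential decay of the Gamma function on vertical lines\<close>

lemma power_le_exp:
  assumes "0 \<le> c" and "0 < d"
  shows "\<exists>K>0. \<forall>x\<ge>0. (c + x) ^ n \<le> K * exp (d * (x::real))"
proof (intro exI conjI allI impI)
  show "0 < fact n / d ^ n * exp (d * c)" using assms by simp
  fix x :: real assume "0 \<le> x"
  then have "0 \<le> d * (c + x)" using assms by simp
  then have "(\<Sum>k\<in>{n}. (d * (c + x)) ^ k /\<^sub>R fact k) \<le> (\<Sum>k. (d * (c + x)) ^ k /\<^sub>R fact k)"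
    by (intro sum_le_suminf summable_exp_generic) auto
  then have "(d * (c + x)) ^ n / fact n \<le> exp (d * (c + x))"
    by (simp add: exp_def field_simps)
  moreover have exp_split: "exp (d * (c + x)) = exp (d * c) * exp (d * x)"
    by (simp add: distrib_left exp_add)
  ultimately show "(c + x) ^ n \<le> fact n / d ^ n * exp (d * c) * exp (d * x)"
    unfolding power_mult_distrib exp_split using assms by (simp add: divide_simps mult_ac)
qed

lemma norm_Complex_mono: "0 \<le> s \<Longrightarrow> s \<le> s' \<Longrightarrow> norm (Complex s t) * s' \<ge> norm (Complex s' t) * s"
proof -
  assume "0 \<le> s" "s \<le> s'"
  then have "s\<^sup>2 * t\<^sup>2 \<le> s'\<^sup>2 * t\<^sup>2" by (intro mult_right_mono power_mono) auto
  then have "((norm (Complex s' t)) * s)\<^sup>2 \<le> (norm (Complex s t) * s')\<^sup>2"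
    by (simp add: power_mult_distrib cmod_power2 algebra_simps)
  then show ?thesis by (rule power2_le_imp_le) (use \<open>0 \<le> s\<close> \<open>s \<le> s'\<close> in auto)
qed

text \<open>
  By the Euler limit, \<open>\<bar>\<Gamma>(s + \<i> t)\<bar> / \<Gamma>(s)\<close> is the limit of the products of
  \<open>(s + j) / \<bar>s + j + \<i> t\<bar>\<close> over \<open>j \<le> n\<close>, and each factor increases with \<open>s\<close>. This reduces a bound for arbitrary \<open>s\<close> to
  half-integers, where the reflection formula gives the modulus explicitly.
\<close>
lemma norm_Gamma_ratio_mono:
  assumes "0 < s" "s \<le> s'"
  shows "norm (Gamma (Complex s t)) / Gamma s \<le> norm (Gamma (Complex s' t)) / Gamma s'"
proof -
  have lim: "(\<lambda>n. pochhammer s (Suc n) / norm (pochhammer (Complex s t) (Suc n))) \<longlonglongrightarrow> norm (Gamma (Complex s t)) / Gamma s"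
    if "0 < s" for s
  proof -
    have *: "norm (Gamma_series (Complex s t) n) / Gamma_series s n = pochhammer s (Suc n) / norm (pochhammer (Complex s t) (Suc n))" for n
    proof -
      have "norm (exp (Complex s t * of_real (ln (real n)))) = exp (s * ln (real n))"
        by (simp add: norm_exp_eq_Re)
      then show ?thesis by (simp add: Gamma_series_def norm_mult norm_divide del: of_nat_Suc)
    qed
    have "Gamma s \<noteq> 0" using Gamma_real_pos[OF that] by simp
    then have "(\<lambda>n. norm (Gamma_series (Complex s t) n) / Gamma_series s n) \<longlonglongrightarrow> norm (Gamma (Complex s t)) / Gamma s"
      by (intro tendsto_intros)
    then show ?thesis unfolding * .
  qed
  have le: "pochhammer s n / norm (pochhammer (Complex s t) n) \<le> pochhammer s' n / norm (pochhammer (Complex s' t) n)" for n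
  proof (induction n)
    case (Suc n)
    have shift: "Complex r t + of_nat n = Complex (r + n) t" for r :: real by (simp add: complex_eq_iff)
    have pos: "0 < norm (Complex (r + n) t)" if "0 < r" for r :: real using that by (simp add: complex_eq_iff)
    have "(s + n) / norm (Complex (s + n) t) \<le> (s' + n) / norm (Complex (s' + n) t)"
      using norm_Complex_mono[of "s + n" "s' + n" t] pos[of s] pos[of s'] assms by (simp add: field_simps)
    then have "pochhammer s n / norm (pochhammer (Complex s t) n) * ((s + n) / norm (Complex (s + n) t))
       \<le> pochhammer s' n / norm (pochhammer (Complex s' t) n) * ((s' + n) / norm (Complex (s' + n) t))"
      using assms by (intro mult_mono Suc) (auto intro!: divide_nonneg_nonneg pochhammer_nonneg)
    then show ?case by (simp add: pochhammer_Suc shift norm_mult)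
  qed simp
  show ?thesis
    using assms by (intro LIMSEQ_le[OF lim lim] exI allI impI le) auto
qed

lemma norm_Gamma_half_squared:
  "(norm (Gamma (Complex (1/2) t)))\<^sup>2 = pi / cosh (pi * t)"
proof -
  have "(of_real ((norm (Gamma (Complex (1/2) t)))\<^sup>2) :: complex) = Gamma (Complex (1/2) t) * cnj (Gamma (Complex (1/2) t))"
    by (rule complex_norm_square)
  also have "\<dots> = Gamma (Complex (1/2) t) * Gamma (1 - Complex (1/2) t)"
    unfolding cnj_Gamma by (rule arg_cong[of _ _ "\<lambda>u. Gamma _ * Gamma u"]) (simp add: complex_eq_iff)
  also have "\<dots> = of_real pi / sin (of_real pi * Complex (1/2) t)" by (rule Gamma_reflection_complex)
  also have "of_real pi * Complex (1/2) t = of_real pi / 2 - (- (\<i> * of_real (pi * t)))"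
    by (simp add: complex_eq_iff)
  also have "sin \<dots> = cos (- (\<i> * of_real (pi * t)))"
    by (simp only: sin_diff) simp
  also have "\<dots> = of_real (cosh (pi * t))"
    by (simp only: cos_minus cosh_conv_cos[symmetric] cosh_def of_real_add of_real_mult exp_of_real[symmetric] of_real_minus) (simp add: scaleR_conv_of_real exp_of_real[symmetric] flip: of_real_mult)
  finally show ?thesis by (simp only: of_real_eq_iff flip: of_real_divide)
qed

text \<open>
  The true rate is \<open>\<pi>/2\<close> up to powers of \<open>t\<close>. The rate \<open>1\<close> absorbs these powers and is still
  larger than \<open>\<pi>/4\<close>, which is all that four Gamma functions against one cosine require.
\<close>
lemma norm_Gamma_le_exp:
  assumes "0 < s0"
  shows "\<exists>K>0. \<forall>z. s0 \<le> Re z \<and> Re z \<le> s1 \<longrightarrow> norm (Gamma z) \<le> K * exp (- \<bar>Im z\<bar>)"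
proof -
  obtain m :: nat where m: "s1 \<le> m" "s0 \<le> m" using real_arch_simple[of "max s0 s1"] by auto
  \<comment> \<open>any half-integer at least \<open>s0\<close> and \<open>s1\<close> serves for the comparison\<close>
  define M where "M = 1/2 + real m"
  have "compact (Gamma ` {s0..M})"
    using assms by (intro compact_continuous_image continuous_intros) auto
  then have "bdd_above (Gamma ` {s0..M})"
    by (intro bounded_imp_bdd_above compact_imp_bounded)
  then obtain C where "\<forall>x\<in>Gamma ` {s0..M}. x \<le> C"
    unfolding bdd_above_def by blast
  then have C: "Gamma s \<le> C" if "s0 \<le> s" "s \<le> M" for s
    using that by auto
  have "Gamma M \<le> C" using C[of M] m by (auto simp: M_def)
  moreover have GM: "Gamma M > 0" by (simp add: M_def Gamma_real_pos)
  ultimately have "C > 0" by linarith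
  obtain K1 where K1: "K1 > 0" "\<And>x::real. x \<ge> 0 \<Longrightarrow> (real m + x) ^ (2 * m) \<le> K1 * exp (1 * x)"
    using power_le_exp[of m 1 "2 * m"] by auto
  define K where "K = C / Gamma M * sqrt (K1 * (2 * pi))"
  have "norm (Gamma z) \<le> K * exp (- \<bar>Im z\<bar>)" if z: "s0 \<le> Re z" "Re z \<le> s1" for z
  proof -
    define t where "t = Im z"
    have "norm (pochhammer (Complex (1/2) t) k) \<le> (real m + \<bar>t\<bar>) ^ k" if "k \<le> m" for k
      using that
    proof (induction k)
      case (Suc k)
      have "Complex (1/2) t + of_nat k = Complex (1/2 + k) t" by (simp add: complex_eq_iff)
      moreover have "norm (Complex (1/2 + k) t) \<le> m + \<bar>t\<bar>"
        using cmod_le[of "Complex (1/2 + k) t"] Suc.prems by simp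
      ultimately show ?case
        using Suc by (simp add: pochhammer_Suc norm_mult mult.commute[of _ "(real m + \<bar>t\<bar>) ^ k"] mult_mono)
    qed simp
    from power_mono[OF this[of m], of 2]
    have poch: "(norm (pochhammer (Complex (1/2) t) m))\<^sup>2 \<le> K1 * exp \<bar>t\<bar>"
      using K1(2)[of "\<bar>t\<bar>"] by (simp add: power_mult[symmetric] mult.commute)
    \<comment> \<open>of the decay \<open>e\<^bsup>-\<pi>|t|\<^esup>\<close>, a rate of three is kept: two for the square of the claim, one to absorb the Pochhammer factor\<close>
    have cosh: "pi / cosh (pi * t) \<le> 2 * pi * exp (- (3 * \<bar>t\<bar>))"
    proof -
      have "exp (3 * \<bar>t\<bar>) \<le> exp (pi * \<bar>t\<bar>)" using pi_gt3 by (simp add: mult_right_mono)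
      also have "\<dots> \<le> 2 * cosh (pi * t)"
        by (cases "t \<ge> 0") (auto simp: cosh_def)
      finally show ?thesis by (simp add: exp_minus field_simps cosh_real_pos)
    qed
    have "Complex (1/2) t \<notin> \<int>\<^sub>\<le>\<^sub>0" by (auto elim!: nonpos_Ints_cases simp: complex_eq_iff)
    moreover have "Complex (1/2) t + of_nat m = Complex M t" by (simp add: complex_eq_iff M_def)
    ultimately have "Gamma (Complex M t) = pochhammer (Complex (1/2) t) m * Gamma (Complex (1/2) t)"
      using pochhammer_Gamma[of "Complex (1/2) t" m] by (simp add: Gamma_eq_zero_iff)
    then have "(norm (Gamma (Complex M t)))\<^sup>2 = (norm (pochhammer (Complex (1/2) t) m))\<^sup>2 * (pi / cosh (pi * t))"
      by (simp only: norm_mult power_mult_distrib norm_Gamma_half_squared)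
    also have "\<dots> \<le> (K1 * exp \<bar>t\<bar>) * (2 * pi * exp (- (3 * \<bar>t\<bar>)))"
      using K1(1) by (intro mult_mono poch cosh) (auto simp: cosh_real_nonneg)
    also have "\<dots> = (sqrt (K1 * (2 * pi)) * exp (- \<bar>t\<bar>))\<^sup>2"
      using K1(1) by (simp add: power_mult_distrib exp_double[symmetric] mult.assoc exp_add[symmetric] mult.left_commute[of "exp _"])
    finally have GMt: "norm (Gamma (Complex M t)) \<le> sqrt (K1 * (2 * pi)) * exp (- \<bar>t\<bar>)"
      by (rule power2_le_imp_le) (use K1(1) in auto)
    have pos: "Gamma (Re z) > 0" using z assms by (intro Gamma_real_pos) auto
    have zM: "Re z \<le> M" using z m by (simp add: M_def)
    have "norm (Gamma z) / Gamma (Re z) \<le> norm (Gamma (Complex M t)) / Gamma M"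
      using norm_Gamma_ratio_mono[of "Re z" M t] z zM assms by (simp add: t_def)
    then have "norm (Gamma z) \<le> Gamma (Re z) * (norm (Gamma (Complex M t)) / Gamma M)"
      using pos by (simp add: field_simps)
    also have "\<dots> \<le> C * (sqrt (K1 * (2 * pi)) * exp (- \<bar>t\<bar>) / Gamma M)"
      using GM GMt C[of "Re z"] z zM \<open>C > 0\<close> by (intro mult_mono divide_right_mono) auto
    finally show ?thesis by (simp add: K_def t_def)
  qed
  moreover have "K > 0" using \<open>C > 0\<close> GM K1(1) by (simp add: K_def)
  ultimately show ?thesis by blast
qed

lemma norm_cos_le_exp_Im: "norm (cos z) \<le> exp \<bar>Im z\<bar>" for z :: complex
proof -
  have "norm (exp (\<i> * z)) \<le> exp \<bar>Im z\<bar>" "norm (exp (- (\<i> * z))) \<le> exp \<bar>Im z\<bar>"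
    by (auto simp: norm_exp_eq_Re)
  from order_trans[OF norm_triangle_ineq add_mono[OF this]]
  have "norm (exp (\<i> * z) + exp (- (\<i> * z))) \<le> 2 * exp \<bar>Im z\<bar>"
    by simp
  then show ?thesis by (simp add: cos_exp_eq norm_divide)
qed

lemma norm_poly_le_power:
  fixes p :: "'a :: real_normed_field poly"
  shows "\<exists>C\<ge>0. \<exists>n. \<forall>x. norm (poly p x) \<le> C * (1 + norm x) ^ n"
proof (induction p)
  case 0
  show ?case by (rule exI[of _ 0]) auto
next
  case (pCons c p)
  then obtain C n where C: "C \<ge> 0" "\<And>x. norm (poly p x) \<le> C * (1 + norm x) ^ n" by blast
  have "norm (poly (pCons c p) x) \<le> (norm c + C) * (1 + norm x) ^ Suc n" for x
  proof -
    have "norm (poly (pCons c p) x) \<le> norm c + norm x * (C * (1 + norm x) ^ n)"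
      using C by (simp add: norm_mult mult_left_mono order_trans[OF norm_triangle_ineq])
    also have "norm c \<le> norm c * (1 + norm x) ^ Suc n"
      using mult_left_mono[OF one_le_power[of "1 + norm x" "Suc n"], of "norm c"] by (simp del: power_Suc)
    also have "norm x * (C * (1 + norm x) ^ n) \<le> (1 + norm x) * (C * (1 + norm x) ^ n)"
      using C(1) by (intro mult_right_mono) auto
    finally show ?thesis by (simp add: algebra_simps)
  qed
  then show ?case using C(1) by (intro exI[of _ "norm c + C"] conjI exI[of _ "Suc n"]) auto
qed

text \<open>
  The four arguments are kept independent of \<open>z\<close> apart from their imaginary parts, so that one bound serves both
  for the weight on the imaginary axis and for the shifted integrand in the strip. The extra power of
  \<open>1 + \<bar>Im z\<bar>\<close> is for polynomial factors.
\<close>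
lemma Gamma_product_decay:
  assumes "0 < s0"
  obtains K where "\<And>z1 z2 z3 z4 z. Re ` {z1, z2, z3, z4} \<subseteq> {s0..s1} \<Longrightarrow> (\<lambda>w. \<bar>Im w\<bar>) ` {z1, z2, z3, z4} \<subseteq> {\<bar>Im z\<bar>} \<Longrightarrow>
     norm (Gamma z1 * Gamma z2 * Gamma z3 * Gamma z4 * cos (of_real pi * z)) * (1 + \<bar>Im z\<bar>) ^ n \<le> K * inverse (1 + (Im z)\<^sup>2)"
proof -
  obtain K0 where K0: "K0 > 0" "\<And>z. s0 \<le> Re z \<Longrightarrow> Re z \<le> s1 \<Longrightarrow> norm (Gamma z) \<le> K0 * exp (- \<bar>Im z\<bar>)"
    using norm_Gamma_le_exp[OF assms, of s1] by blast
  obtain K1 where K1: "K1 > 0" "\<And>x::real. x \<ge> 0 \<Longrightarrow> (1 + x) ^ (n + 2) \<le> K1 * exp ((4 - pi) * x)"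
    using power_le_exp[of 1 "4 - pi" "n + 2"] pi_less_4 by auto
  have "norm (Gamma z1 * Gamma z2 * Gamma z3 * Gamma z4 * cos (of_real pi * z)) * (1 + \<bar>Im z\<bar>) ^ n \<le> K0 ^ 4 * K1 * inverse (1 + (Im z)\<^sup>2)"
    if "Re ` {z1, z2, z3, z4} \<subseteq> {s0..s1}" "(\<lambda>w. \<bar>Im w\<bar>) ` {z1, z2, z3, z4} \<subseteq> {\<bar>Im z\<bar>}" for z1 z2 z3 z4 z
  proof -
    define t where "t = \<bar>Im z\<bar>"
    have t: "t \<ge> 0" by (simp add: t_def)
    have g: "norm (Gamma z') \<le> K0 * exp (- t)" if "z' \<in> {z1, z2, z3, z4}" for z'
      using K0(2)[of z'] that \<open>Re ` _ \<subseteq> _\<close> \<open>(\<lambda>w. \<bar>Im w\<bar>) ` _ \<subseteq> _\<close> by (auto simp: t_def)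
    have c: "norm (cos (of_real pi * z)) \<le> exp (pi * t)"
      using norm_cos_le_exp_Im[of "of_real pi * z"] by (simp add: t_def abs_mult)
    have "norm (Gamma z1 * Gamma z2 * Gamma z3 * Gamma z4 * cos (of_real pi * z))
        \<le> (K0 * exp (- t)) * (K0 * exp (- t)) * (K0 * exp (- t)) * (K0 * exp (- t)) * exp (pi * t)"
      unfolding norm_mult using K0(1) by (intro mult_mono g c) auto
    also have "\<dots> = K0 ^ 4 * exp (- ((4 - pi) * t))"
      by (simp add: power4_eq_xxxx mult_ac exp_add[symmetric] algebra_simps mult_exp_exp)
    finally have "norm (Gamma z1 * Gamma z2 * Gamma z3 * Gamma z4 * cos (of_real pi * z)) * (1 + t) ^ n
      \<le> K0 ^ 4 * exp (- ((4 - pi) * t)) * (1 + t) ^ n"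
      by (rule mult_right_mono) (use t in auto)
    also have "(1 + t) ^ n \<le> K1 * exp ((4 - pi) * t) * inverse (1 + t\<^sup>2)"
    proof -
      have "1 + t\<^sup>2 \<le> (1 + t)\<^sup>2" using t by (simp add: power2_eq_square algebra_simps)
      then have "(1 + t) ^ n * (1 + t\<^sup>2) \<le> (1 + t) ^ n * (1 + t)\<^sup>2" using t by (intro mult_left_mono) auto
      also have "\<dots> \<le> K1 * exp ((4 - pi) * t)" unfolding power_add[symmetric] by (rule K1(2)[OF t])
      finally show ?thesis by (simp add: field_simps add_pos_nonneg)
    qed
    also have "K0 ^ 4 * exp (- ((4 - pi) * t)) * (K1 * exp ((4 - pi) * t) * inverse (1 + t\<^sup>2))
        = K0 ^ 4 * K1 * inverse (1 + t\<^sup>2)"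
      by (simp add: exp_minus)
    finally show ?thesis using K0(1) by (simp add: t_def)
  qed
  then show ?thesis by (rule that)
qed

section \<open>Shifting a vertical line of integration\<close>

lemma integrable_inverse_1_plus_square_lborel:
  "integrable lborel (\<lambda>x::real. inverse (1 + x\<^sup>2))"
  using integrable_inverse_1_plus_square by (simp add: set_integrable_def)

text \<open>
  Cauchy's theorem on the rectangle with vertical sides on the two lines and horizontal sides at height
  \<open>\<plusminus>R\<close>; the decay hypothesis bounds the horizontal contribution by \<open>2 c K / (1 + R\<^sup>2)\<close>.
\<close>
lemma integral_vertical_line_shift:
  fixes f :: "complex \<Rightarrow> complex" and c :: real
  assumes "c > 0" and "e > 0"
    and holo: "f holomorphic_on {z. - e < Re z \<and> Re z < c + e}"
    and decay: "\<And>z. 0 \<le> Re z \<Longrightarrow> Re z \<le> c \<Longrightarrow> norm (f z) \<le> K * inverse (1 + (Im z)\<^sup>2)"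
  shows "(LINT t|lborel. f (Complex 0 t)) = (LINT t|lborel. f (Complex c t))"
proof -
  define T where "T = {z. - e < Re z \<and> Re z < c + e}"
  have "T = {z. Re z > - e} \<inter> {z. Re z < c + e}"
    by (auto simp: T_def)
  then have "convex T"
    by (simp add: convex_Int convex_halfspace_Re_gt convex_halfspace_Re_lt)
  have holT: "f holomorphic_on T" and contT: "continuous_on T f"
    using holo holomorphic_on_imp_continuous_on by (auto simp: T_def)
  have inT: "Complex \<sigma> t \<in> T" if "0 \<le> \<sigma>" "\<sigma> \<le> c" for \<sigma> t
    using that assms(1,2) by (auto simp: T_def)
  have cont_line: "continuous_on A (\<lambda>t. f (Complex \<sigma> t))" if "0 \<le> \<sigma>" "\<sigma> \<le> c" for \<sigma> A
    by (rule continuous_on_compose2[OF contT]) (use inT that in \<open>auto simp: Complex_eq intro!: continuous_intros\<close>)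
  have int_line: "integrable lborel (\<lambda>t. f (Complex \<sigma> t))" if "0 \<le> \<sigma>" "\<sigma> \<le> c" for \<sigma>
  proof (rule Bochner_Integration.integrable_bound)
    show "integrable lborel (\<lambda>t. K * inverse (1 + t\<^sup>2))"
      using integrable_inverse_1_plus_square_lborel by simp
    show "(\<lambda>t. f (Complex \<sigma> t)) \<in> borel_measurable lborel"
      using borel_measurable_continuous_onI[OF cont_line[OF that]] by simp
    show "AE t in lborel. norm (f (Complex \<sigma> t)) \<le> norm (K * inverse (1 + t\<^sup>2))"
      using decay[of "Complex \<sigma> _"] that by (intro AE_I2) (force intro: order_trans[OF _ abs_ge_self])
  qed
  define I where "I = (\<lambda>\<sigma> R. integral {-R..R} (\<lambda>t. f (Complex \<sigma> t)))"
  have lim: "(I \<sigma> \<longlongrightarrow> (LINT t|lborel. f (Complex \<sigma> t))) at_top" if "0 \<le> \<sigma>" "\<sigma> \<le> c" for \<sigma>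
  proof -
    have "((\<lambda>R. LINT t:{-R..R}|lborel. f (Complex \<sigma> t)) \<longlongrightarrow> (LINT t|lborel. f (Complex \<sigma> t))) at_top"
      unfolding set_lebesgue_integral_def
    proof (rule integral_dominated_convergence_at_top[where w = "\<lambda>t. norm (f (Complex \<sigma> t))"])
      show "AE t in lborel. ((\<lambda>R. indicat_real {-R..R} t *\<^sub>R f (Complex \<sigma> t)) \<longlongrightarrow> f (Complex \<sigma> t)) at_top"
      proof (intro AE_I2 tendsto_eventually)
        fix t :: real
        show "\<forall>\<^sub>F R in at_top. indicat_real {- R..R} t *\<^sub>R f (Complex \<sigma> t) = f (Complex \<sigma> t)"
          using eventually_ge_at_top[of "\<bar>t\<bar>"] by eventually_elim (auto simp: indicator_def)
      qed
    qed (use int_line[OF that] in \<open>auto simp: indicator_def\<close>)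
    moreover have "set_lebesgue_integral lborel {-R..R} (\<lambda>t. f (Complex \<sigma> t)) = I \<sigma> R" for R
      unfolding I_def
      by (rule set_borel_integral_eq_integral) (rule borel_integrable_atLeastAtMost'[OF cont_line[OF that]])
    ultimately show ?thesis by simp
  qed
  have bound: "norm (I 0 R - I c R) \<le> 2 * c * (K * inverse (1 + R\<^sup>2))" if "R > 0" for R
  proof -
    define p1 p2 p3 p4 where "p1 = Complex 0 (-R)" and "p2 = Complex c (-R)" and "p3 = Complex c R" and "p4 = Complex 0 R"
    note p_defs = p1_def p2_def p3_def p4_def
    have pT: "p1 \<in> T" "p2 \<in> T" "p3 \<in> T" "p4 \<in> T" using inT assms(1) by (auto simp: p_defs)
    have segT: "closed_segment x y \<subseteq> T" if "x \<in> T" "y \<in> T" for x y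
      using \<open>convex T\<close> that by (simp add: closed_segment_subset)
    have ci: "f contour_integrable_on linepath x y" if "x \<in> T" "y \<in> T" for x y
      by (rule contour_integrable_continuous_linepath) (use contT continuous_on_subset segT that in blast)
    have "(f has_contour_integral 0) (linepath p1 p2 +++ linepath p2 p3 +++ linepath p3 p4 +++ linepath p4 p1)"
      by (rule Cauchy_theorem_convex_simple[OF holT \<open>convex T\<close>])
        (use pT segT in \<open>auto intro!: valid_path_join simp: path_image_join\<close>)
    from contour_integral_unique[OF this]
    have "contour_integral (linepath p1 p2) f + (contour_integral (linepath p2 p3) f +
        (contour_integral (linepath p3 p4) f + contour_integral (linepath p4 p1) f)) = 0"
      using ci pT by (simp add: contour_integral_join contour_integrable_join)
    moreover have "contour_integral (linepath p2 p3) f = \<i> * I c R"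
      unfolding I_def by (rule contour_integral_linepath_same_Re) (use that in \<open>auto simp: p_defs\<close>)
    moreover have "contour_integral (linepath p4 p1) f = - (\<i> * I 0 R)"
    proof -
      have "contour_integral (linepath p1 p4) f = \<i> * I 0 R"
        unfolding I_def by (rule contour_integral_linepath_same_Re) (use that in \<open>auto simp: p_defs\<close>)
      then show ?thesis using contour_integral_reverse_linepath[of p4 p1 f]
        by (metis (no_types, lifting) contT continuous_on_subset pT(1,4) segT)
    qed
    ultimately have eq: "\<i> * (I 0 R - I c R) = contour_integral (linepath p1 p2) f + contour_integral (linepath p3 p4) f"
      by (simp add: algebra_simps add_eq_0_iff)
    have "norm (f (Complex 0 R)) \<le> K * inverse (1 + R\<^sup>2)"
      using decay[of "Complex 0 R"] assms(1) by simp
    then have K: "0 \<le> K * inverse (1 + R\<^sup>2)"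
      by (rule order_trans[OF norm_ge_zero])
    have n1: "norm (contour_integral (linepath p1 p2) f) \<le> (K * inverse (1 + R\<^sup>2)) * norm (p2 - p1)"
    proof (rule contour_integral_bound_linepath[OF ci[OF pT(1,2)] K])
      fix z assume "z \<in> closed_segment p1 p2"
      then obtain v where v: "0 \<le> v" "v \<le> 1" "z = (1 - v) *\<^sub>R p1 + v *\<^sub>R p2"
        by (auto simp: closed_segment_def)
      have "Im z = -R" "Re z = v * c" unfolding v(3) p_defs by (simp_all add: algebra_simps)
      then have "Im z = -R" "0 \<le> Re z" "Re z \<le> c"
        using v(1,2) assms(1) by (auto simp: mult_left_le_one_le)
      then show "norm (f z) \<le> K * inverse (1 + R\<^sup>2)" using decay[of z] by simp
    qed
    have n2: "norm (contour_integral (linepath p3 p4) f) \<le> (K * inverse (1 + R\<^sup>2)) * norm (p4 - p3)"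
    proof (rule contour_integral_bound_linepath[OF ci[OF pT(3,4)] K])
      fix z assume "z \<in> closed_segment p3 p4"
      then have "z \<in> closed_segment p4 p3" by (simp add: closed_segment_commute)
      then obtain v where v: "0 \<le> v" "v \<le> 1" "z = (1 - v) *\<^sub>R p4 + v *\<^sub>R p3"
        by (auto simp: closed_segment_def)
      have "Im z = R" "Re z = v * c" unfolding v(3) p_defs by (simp_all add: algebra_simps)
      then have "Im z = R" "0 \<le> Re z" "Re z \<le> c"
        using v(1,2) assms(1) by (auto simp: mult_left_le_one_le)
      then show "norm (f z) \<le> K * inverse (1 + R\<^sup>2)" using decay[of z] by simp
    qed
    have "norm (p2 - p1) = c" "norm (p4 - p3) = c" using assms(1) by (auto simp: p_defs cmod_def)
    moreover have "norm (I 0 R - I c R) = norm (\<i> * (I 0 R - I c R))" by (simp add: norm_mult)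
    ultimately show ?thesis
      using n1 n2 norm_triangle_ineq[of "contour_integral (linepath p1 p2) f" "contour_integral (linepath p3 p4) f"]
      unfolding eq by (simp add: algebra_simps)
  qed
  have "((\<lambda>R. 2 * c * (K * inverse (1 + R\<^sup>2))) \<longlongrightarrow> 2 * c * (K * 0)) at_top"
    by (intro tendsto_intros tendsto_inverse_0_at_top filterlim_tendsto_add_at_top[OF tendsto_const]
        filterlim_pow_at_top filterlim_ident) simp_all
  then have to_0: "((\<lambda>R. 2 * c * (K * inverse (1 + R\<^sup>2))) \<longlongrightarrow> 0) at_top"
    by simp
  have "\<forall>\<^sub>F R in at_top. norm (I 0 R - I c R) \<le> 2 * c * (K * inverse (1 + R\<^sup>2))"
    using eventually_gt_at_top[of 0] by eventually_elim (rule bound)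
  from Lim_null_comparison[OF this to_0] have "((\<lambda>R. I 0 R - I c R) \<longlongrightarrow> 0) at_top" .
  moreover have "((\<lambda>R. I 0 R - I c R) \<longlongrightarrow> (LINT t|lborel. f (Complex 0 t)) - (LINT t|lborel. f (Complex c t))) at_top"
    using assms(1) by (intro tendsto_diff lim) auto
  ultimately have "0 = (LINT t|lborel. f (Complex 0 t)) - (LINT t|lborel. f (Complex c t))"
    by (rule tendsto_unique[OF trivial_limit_at_top_linorder])
  then show ?thesis by simp
qed

section \<open>The weight and its moments\<close>

text \<open>
  The analytic continuation of the weight off the line \<open>z = 2 \<i> x\<close>: the reflection formula has replaced
  \<open>1 / (\<Gamma>(1/2 + z) \<Gamma>(1/2 - z))\<close> by \<open>cos (\<pi> z) / \<pi>\<close>.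
\<close>
definition dual_hahn_weight :: "real \<Rightarrow> real \<Rightarrow> complex \<Rightarrow> complex" where
  "dual_hahn_weight a b z = Gamma (of_real a + z) * Gamma (of_real a - z) * Gamma (of_real b + z) * Gamma (of_real b - z)
     * cos (of_real pi * z) / of_real pi"

lemma not_nonpos_Ints_Re_pos: "Re z > 0 \<Longrightarrow> z \<notin> \<int>\<^sub>\<le>\<^sub>0"
  by (auto elim!: nonpos_Ints_cases)

lemma dual_hahn_weight_on_line:
  fixes a b x :: real
  shows "of_real ((cmod (Gamma (of_real a + 2 * \<i> * of_real x) * Gamma (of_real b + 2 * \<i> * of_real x)
            / Gamma (1/2 + 2 * \<i> * of_real x)))\<^sup>2) = dual_hahn_weight a b (2 * \<i> * of_real x)"
proof -
  define z :: complex where "z = 2 * \<i> * of_real x"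
  have cnj_z: "cnj z = - z" by (simp add: z_def)
  have "Gamma (1/2 + z) * Gamma (1/2 - z) = Gamma (1/2 + z) * Gamma (1 - (1/2 + z))" by simp
  also have "\<dots> = of_real pi / cos (of_real pi * z)"
    unfolding Gamma_reflection_complex by (simp add: distrib_left sin_add)
  finally have "cos (of_real pi * z) / of_real pi = inverse (Gamma (1/2 + z) * Gamma (1/2 - z))" by simp
  then have weight_eq: "dual_hahn_weight a b z = Gamma (of_real a + z) * Gamma (of_real a - z) * Gamma (of_real b + z) * Gamma (of_real b - z)
     * inverse (Gamma (1/2 + z) * Gamma (1/2 - z))"
    by (simp only: dual_hahn_weight_def times_divide_eq_right[symmetric])
  have "cnj (Gamma (of_real c + z)) = Gamma (of_real c - z)" for c
    unfolding cnj_Gamma by (simp add: cnj_z)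
  from this[of a] this[of b] this[of "1/2"]
  have "cnj (Gamma (of_real a + z) * Gamma (of_real b + z) / Gamma (1/2 + z))
      = Gamma (of_real a - z) * Gamma (of_real b - z) / Gamma (1/2 - z)"
    by simp
  note cnj_eq = this
  show ?thesis
    unfolding z_def[symmetric] complex_norm_square cnj_eq weight_eq
    by (simp only: divide_inverse inverse_mult_distrib mult_ac)
qed

lemma dual_hahn_weight_Suc:
  assumes "a > 0" "Re z = 0"
  shows "dual_hahn_weight (a + 1) b z = ((of_real a)\<^sup>2 - z\<^sup>2) * dual_hahn_weight a b z"
proof -
  have "Gamma (of_real (a + 1) + z) = (of_real a + z) * Gamma (of_real a + z)"
    using Gamma_plus1[OF not_nonpos_Ints_Re_pos, of "of_real a + z"] assms by (simp add: add_ac)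
  moreover have "Gamma (of_real (a + 1) - z) = (of_real a - z) * Gamma (of_real a - z)"
    using Gamma_plus1[OF not_nonpos_Ints_Re_pos, of "of_real a - z"] assms by (simp add: algebra_simps)
  ultimately show ?thesis
    by (simp only: dual_hahn_weight_def) (simp add: power2_eq_square field_simps)
qed

lemma dual_hahn_weight_pochhammer:
  assumes "a > 0" "Re z = 0"
  shows "pochhammer (of_real a + z) k * pochhammer (of_real a - z) k * dual_hahn_weight a b z
       = dual_hahn_weight (a + real k) b z"
proof (induction k)
  case (Suc k)
  have "dual_hahn_weight (a + real (Suc k)) b z = ((of_real (a + k))\<^sup>2 - z\<^sup>2) * dual_hahn_weight (a + k) b z"
    using dual_hahn_weight_Suc[of "a + k" z b] assms by (simp add: add_ac)
  then show ?case by (simp add: Suc[symmetric] pochhammer_Suc power2_eq_square algebra_simps)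
qed simp

lemma integrable_dual_hahn_weight:
  assumes "a > 0" "b > 0"
  shows "integrable lborel (\<lambda>x::real. dual_hahn_weight a b (2 * \<i> * of_real x) * poly p (of_real x))"
proof -
  define s where "s = min a b"
  obtain C n where C: "C \<ge> 0" "\<And>x. norm (poly p x) \<le> C * (1 + norm x) ^ n"
    using norm_poly_le_power by blast
  obtain K where K: "\<And>z1 z2 z3 z4 z. Re ` {z1, z2, z3, z4} \<subseteq> {s..max a b} \<Longrightarrow> (\<lambda>w. \<bar>Im w\<bar>) ` {z1, z2, z3, z4} \<subseteq> {\<bar>Im z\<bar>} \<Longrightarrow>
     norm (Gamma z1 * Gamma z2 * Gamma z3 * Gamma z4 * cos (of_real pi * z)) * (1 + \<bar>Im z\<bar>) ^ n \<le> K * inverse (1 + (Im z)\<^sup>2)"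
    by (rule Gamma_product_decay[of s "max a b" n]) (use assms in \<open>auto simp: s_def\<close>)
  show ?thesis
  proof (rule Bochner_Integration.integrable_bound)
    show "integrable lborel (\<lambda>x. K / pi * C * inverse (1 + x\<^sup>2))"
      using integrable_inverse_1_plus_square_lborel by simp
    have "dual_hahn_weight a b holomorphic_on {z. \<bar>Re z\<bar> < s}"
      unfolding dual_hahn_weight_def s_def
      by (intro holomorphic_intros) (auto intro!: not_nonpos_Ints_Re_pos)
    then have "continuous_on UNIV (\<lambda>x. dual_hahn_weight a b (2 * \<i> * complex_of_real x))"
      by (rule continuous_on_compose2[OF holomorphic_on_imp_continuous_on])
        (use assms in \<open>auto simp: s_def intro!: continuous_intros\<close>)
    then have "continuous_on UNIV (\<lambda>x. dual_hahn_weight a b (2 * \<i> * complex_of_real x) * poly p (complex_of_real x))"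
      by (rule continuous_on_mult) (intro continuous_intros)
    then show "(\<lambda>x. dual_hahn_weight a b (2 * \<i> * complex_of_real x) * poly p (complex_of_real x)) \<in> borel_measurable lborel"
      using borel_measurable_continuous_onI by simp
    have "norm (dual_hahn_weight a b (2 * \<i> * of_real x) * poly p (of_real x)) \<le> K / pi * C * inverse (1 + x\<^sup>2)" for x :: real
    proof -
      define z where "z = 2 * \<i> * complex_of_real x"
      let ?G = "norm (Gamma (of_real a + z) * Gamma (of_real a - z) * Gamma (of_real b + z) * Gamma (of_real b - z)
        * cos (of_real pi * z))"
      have G: "?G * (1 + \<bar>2 * x\<bar>) ^ n \<le> K * inverse (1 + (2 * x)\<^sup>2)"
        using K[of "of_real a + z" "of_real a - z" "of_real b + z" "of_real b - z" z] by (simp add: z_def s_def)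
      have "0 \<le> K * inverse (1 + (2 * x)\<^sup>2)" by (rule order_trans[OF _ G]) auto
      moreover have "K \<ge> 0" if "0 \<le> K * inverse q" "q > 0" for q
        using that by (simp add: zero_le_mult_iff)
      ultimately have "K \<ge> 0" by (simp add: add_pos_nonneg)
      have "norm (dual_hahn_weight a b z * poly p (of_real x)) = ?G / pi * norm (poly p (of_real x))"
        by (simp add: dual_hahn_weight_def norm_mult norm_divide)
      also have "\<dots> \<le> ?G / pi * (C * (1 + \<bar>2 * x\<bar>) ^ n)"
        using C by (intro mult_left_mono order_trans[OF C(2)] power_mono) auto
      also have "?G / pi * (C * (1 + \<bar>2 * x\<bar>) ^ n) = C / pi * (?G * (1 + \<bar>2 * x\<bar>) ^ n)"
        by simp
      also have "\<dots> \<le> C / pi * (K * inverse (1 + (2 * x)\<^sup>2))"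
        using C(1) by (intro mult_left_mono G) auto
      also have "\<dots> \<le> C / pi * (K * inverse (1 + x\<^sup>2))"
        using C(1) \<open>K \<ge> 0\<close> by (intro mult_left_mono le_imp_inverse_le) (auto simp: power_mult_distrib add_pos_nonneg)
      finally show ?thesis by (simp add: z_def mult_ac)
    qed
    then show "AE x in lborel. norm (dual_hahn_weight a b (2 * \<i> * of_real x) * poly p (of_real x)) \<le> norm (K / pi * C * inverse (1 + x\<^sup>2))"
      unfolding real_norm_def by (intro AE_I2 order_trans[OF _ abs_ge_self]) blast
  qed
qed

text \<open>
  The first non-trivial moment. The function \<open>G\<close> below satisfies \<open>G(z) = -(a - z)(b - z) W(z)\<close> and
  \<open>G(z + 1) = (a + z)(b + z) W(z)\<close> for the weight \<open>W\<close>. Its integrals over \<open>Re z = 0\<close> and \<open>Re z = 1\<close> agree,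
  and \<open>(a + z)(b + z) + (a - z)(b - z) = 2 (a b + z\<^sup>2)\<close>.
\<close>
lemma integral_dual_hahn_weight_basic:
  assumes "a > 0" "b > 0"
  shows "(LINT x|lborel. dual_hahn_weight a b (2 * \<i> * of_real x) * (of_real (a * b) + (2 * \<i> * of_real x)\<^sup>2)) = 0"
proof -
  define G where "G = (\<lambda>z::complex. - (Gamma (of_real a + z) * Gamma (of_real b + z) * Gamma (of_real a + 1 - z) * Gamma (of_real b + 1 - z)
      * cos (of_real pi * z) / of_real pi))"
  define e where "e = min a b / 2"
  have e: "e > 0" "e < a" "e < b" using assms by (auto simp: e_def)
  have holo: "G holomorphic_on {z. - e < Re z \<and> Re z < 1 + e}"
    unfolding G_def using e
    by (intro holomorphic_intros) (auto intro!: not_nonpos_Ints_Re_pos)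
  obtain K where K: "\<And>z1 z2 z3 z4 z. Re ` {z1, z2, z3, z4} \<subseteq> {e..1 + max a b} \<Longrightarrow> (\<lambda>w. \<bar>Im w\<bar>) ` {z1, z2, z3, z4} \<subseteq> {\<bar>Im z\<bar>} \<Longrightarrow>
     norm (Gamma z1 * Gamma z2 * Gamma z3 * Gamma z4 * cos (of_real pi * z)) * (1 + \<bar>Im z\<bar>) ^ 0 \<le> K * inverse (1 + (Im z)\<^sup>2)"
    by (rule Gamma_product_decay[of e "1 + max a b" 0]) (use e in auto)
  have bound: "norm (G z) \<le> (K / pi) * inverse (1 + (Im z)\<^sup>2)" if "0 \<le> Re z" "Re z \<le> 1" for z
  proof -
    have "norm (G z) = norm (Gamma (of_real a + z) * Gamma (of_real b + z) * Gamma (of_real a + 1 - z) * Gamma (of_real b + 1 - z)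
      * cos (of_real pi * z)) / pi" by (simp add: G_def norm_mult norm_divide)
    also have "\<dots> \<le> K * inverse (1 + (Im z)\<^sup>2) / pi"
    proof (rule divide_right_mono)
      let ?A = "{of_real a + z, of_real b + z, of_real a + 1 - z, of_real b + 1 - z}"
      have "Re ` ?A \<subseteq> {e..1 + max a b}" "(\<lambda>w. \<bar>Im w\<bar>) ` ?A \<subseteq> {\<bar>Im z\<bar>}" using that e by auto
      from K[OF this]
      show "norm (Gamma (of_real a + z) * Gamma (of_real b + z) * Gamma (of_real a + 1 - z) * Gamma (of_real b + 1 - z)
        * cos (of_real pi * z)) \<le> K * inverse (1 + (Im z)\<^sup>2)" by simp
    qed simp
    finally show ?thesis by simp
  qed
  have shift: "(LINT t|lborel. G (Complex 0 t)) = (LINT t|lborel. G (Complex 1 t))"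
    by (rule integral_vertical_line_shift[OF _ e(1) holo bound]) simp_all
  have G0: "G z = - ((of_real a - z) * (of_real b - z) * dual_hahn_weight a b z)" if "Re z = 0" for z
  proof -
    have "Gamma (of_real a + 1 - z) = (of_real a - z) * Gamma (of_real a - z)"
      "Gamma (of_real b + 1 - z) = (of_real b - z) * Gamma (of_real b - z)"
      using Gamma_plus1[OF not_nonpos_Ints_Re_pos, of "of_real a - z"]
        Gamma_plus1[OF not_nonpos_Ints_Re_pos, of "of_real b - z"] assms that by (simp_all add: algebra_simps)
    then show ?thesis by (simp add: G_def dual_hahn_weight_def)
  qed
  have G1: "G (1 + z) = (of_real a + z) * (of_real b + z) * dual_hahn_weight a b z" if "Re z = 0" for z
  proof -
    have "Gamma (of_real a + (1 + z)) = (of_real a + z) * Gamma (of_real a + z)"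
      "Gamma (of_real b + (1 + z)) = (of_real b + z) * Gamma (of_real b + z)"
      using Gamma_plus1[OF not_nonpos_Ints_Re_pos, of "of_real a + z"]
        Gamma_plus1[OF not_nonpos_Ints_Re_pos, of "of_real b + z"] assms that by (simp_all add: algebra_simps)
    moreover have "cos (of_real pi * (1 + z)) = - cos (of_real pi * z)"
      by (simp add: distrib_left cos_add)
    ultimately show ?thesis by (simp add: G_def dual_hahn_weight_def)
  qed
  let ?z = "\<lambda>x::real. 2 * \<i> * complex_of_real x"
  have C0: "Complex 0 (2 * x) = ?z x" and C1: "Complex 1 (2 * x) = 1 + ?z x" for x
    by (simp_all add: complex_eq_iff)
  have "(LINT x|lborel. G (?z x)) = (LINT x|lborel. G (1 + ?z x))"
  proof -
    have "(LINT t|lborel. G (Complex 0 t)) = 2 * (LINT x|lborel. G (?z x))"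
      by (subst lborel_integral_real_affine[of 2 _ 0]) (simp_all add: C0 scaleR_conv_of_real)
    moreover have "(LINT t|lborel. G (Complex 1 t)) = 2 * (LINT x|lborel. G (1 + ?z x))"
      by (subst lborel_integral_real_affine[of 2 _ 0]) (simp_all add: C1 scaleR_conv_of_real)
    ultimately show ?thesis using shift by simp
  qed
  moreover have "integrable lborel (\<lambda>x. G (?z x))"
  proof -
    have "G (?z x) = dual_hahn_weight a b (?z x) * poly (- ([:of_real a, - 2 * \<i>:] * [:of_real b, - 2 * \<i>:])) (of_real x)" for x
      using G0[of "?z x"] unfolding poly_minus poly_mult by (simp add: mult_ac)
    then show ?thesis using integrable_dual_hahn_weight[OF assms] by presburger
  qed
  moreover have "integrable lborel (\<lambda>x. G (1 + ?z x))"
  proof -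
    have "G (1 + ?z x) = dual_hahn_weight a b (?z x) * poly ([:of_real a, 2 * \<i>:] * [:of_real b, 2 * \<i>:]) (of_real x)" for x
      using G1[of "?z x"] unfolding poly_mult by (simp add: mult_ac)
    then show ?thesis using integrable_dual_hahn_weight[OF assms] by presburger
  qed
  ultimately have "(LINT x|lborel. G (1 + ?z x) - G (?z x)) = 0"
    by (simp add: Bochner_Integration.integral_diff)
  moreover have "G (1 + z) - G z = 2 * (dual_hahn_weight a b z * (of_real (a * b) + z\<^sup>2))" if "Re z = 0" for z
    using G0[OF that] G1[OF that] by (simp add: power2_eq_square algebra_simps)
  ultimately show ?thesis by simp
qed

text \<open>
  Since \<open>a\<^sup>2 - z\<^sup>2 = a (a + b) - (a b + z\<^sup>2)\<close>, the vanishing moment shows that raising \<open>a\<close> by one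
  multiplies the total mass by \<open>a (a + b)\<close>.
\<close>
lemma integral_dual_hahn_weight_moment:
  assumes "a > 0" "b > 0"
  shows "(LINT x|lborel. dual_hahn_weight (a + real k) b (2 * \<i> * of_real x))
       = of_real (pochhammer a k * pochhammer (a + b) k) * (LINT x|lborel. dual_hahn_weight a b (2 * \<i> * of_real x))"
proof (induction k)
  case (Suc k)
  let ?z = "\<lambda>x::real. 2 * \<i> * complex_of_real x"
  let ?w = "\<lambda>x. dual_hahn_weight (a + real k) b (?z x)"
  have pos: "a + real k > 0" using assms by simp
  have split: "dual_hahn_weight (a + real (Suc k)) b (?z x) =
      of_real ((a + k) * (a + b + k)) * ?w x - ?w x * (of_real ((a + k) * b) + (?z x)\<^sup>2)" for x
    using dual_hahn_weight_Suc[OF pos, of "?z x" b] by (simp add: add_ac power2_eq_square algebra_simps)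
  have int1: "integrable lborel ?w"
    using integrable_dual_hahn_weight[OF pos assms(2), of 1] by simp
  have int2: "integrable lborel (\<lambda>x. ?w x * (of_real ((a + k) * b) + (?z x)\<^sup>2))"
    using integrable_dual_hahn_weight[OF pos assms(2), of "[:of_real ((a + k) * b), 0, -4:]"]
    by (simp add: power2_eq_square algebra_simps)
  have "(LINT x|lborel. dual_hahn_weight (a + real (Suc k)) b (?z x)) =
      (LINT x|lborel. of_real ((a + k) * (a + b + k)) * ?w x) - (LINT x|lborel. ?w x * (of_real ((a + k) * b) + (?z x)\<^sup>2))"
    unfolding split by (intro Bochner_Integration.integral_diff integrable_mult_right int1 int2)
  also have "\<dots> = of_real ((a + k) * (a + b + k)) * (LINT x|lborel. ?w x)"
    unfolding integral_dual_hahn_weight_basic[OF pos assms(2)] by simp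
  finally have "(LINT x|lborel. dual_hahn_weight (a + real (Suc k)) b (?z x)) = of_real ((a + k) * (a + b + k)) * (LINT x|lborel. ?w x)" .
  then show ?case unfolding Suc pochhammer_Suc by (simp only: of_real_mult mult_ac)
qed simp

lemma dual_hahn_weight_minus: "dual_hahn_weight a b (- z) = dual_hahn_weight a b z"
  by (simp add: dual_hahn_weight_def mult_ac)

lemma hahn_sum_minus: "hahn_sum a c d n (- z) = hahn_sum a c d n z"
  by (simp add: hahn_sum_def hahn_basis_def mult_ac)

text \<open>
  Integrated term by term, the moments cancel the denominators of the coefficients, and the alternating sum of
  binomial coefficients remains.
\<close>
lemma integral_dual_hahn_weight_hahn_sum:
  assumes "a > 0" "b > 0" "n > 0"
  shows "(LINT x|lborel. dual_hahn_weight a b (2 * \<i> * of_real x) * hahn_sum (of_real a) (of_real a) (of_real a + of_real b) n (2 * \<i> * of_real x)) = 0"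
proof -
  let ?z = "\<lambda>x::real. 2 * \<i> * complex_of_real x"
  let ?I = "LINT x|lborel. dual_hahn_weight a b (?z x)"
  define K :: complex where "K = (- 1/4) ^ n * of_real (pochhammer a n * pochhammer (a + b) n)"
  let ?c = "hahn_coeff (of_real a) (of_real a + of_real b) n"
  have "dual_hahn_weight a b (?z x) * hahn_sum (of_real a) (of_real a) (of_real a + of_real b) n (?z x)
      = (\<Sum>k\<le>n. ?c k * dual_hahn_weight (a + k) b (?z x))" for x
    unfolding hahn_sum_def hahn_basis_def sum_distrib_left
    using dual_hahn_weight_pochhammer[OF assms(1), of "?z x" _ b] by (intro sum.cong refl) (simp add: mult_ac)
  then have "(LINT x|lborel. dual_hahn_weight a b (?z x) * hahn_sum (of_real a) (of_real a) (of_real a + of_real b) n (?z x))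
      = (LINT x|lborel. (\<Sum>k\<le>n. ?c k * dual_hahn_weight (a + k) b (?z x)))"
    by (simp only:)
  also have "\<dots> = (\<Sum>k\<le>n. ?c k * (LINT x|lborel. dual_hahn_weight (a + k) b (?z x)))"
  proof (subst Bochner_Integration.integral_sum)
    show "integrable lborel (\<lambda>x. ?c k * dual_hahn_weight (a + k) b (?z x))" for k
      using integrable_dual_hahn_weight[of "a + k" b 1] assms by (intro integrable_mult_right) simp
  qed (simp only: integral_mult_right_zero)
  also have "\<dots> = (\<Sum>k\<le>n. K * ?I * ((- 1) ^ k * of_nat (n choose k)))"
  proof (intro sum.cong refl)
    fix k
    have nz: "pochhammer a k \<noteq> 0" "pochhammer (a + b) k \<noteq> 0"
      using pochhammer_pos[of a k] pochhammer_pos[of "a + b" k] assms by auto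
    have "pochhammer (- of_nat n) k / fact k = (- 1) ^ k * (of_nat (n choose k) :: complex)"
      by (simp add: binomial_gbinomial gbinomial_pochhammer flip: power_add mult_2 mult.assoc)
    moreover have "?c k * of_real (pochhammer a k * pochhammer (a + b) k) = K * (pochhammer (- of_nat n) k / fact k)"
      unfolding hahn_coeff_def K_def of_real_add[symmetric] pochhammer_of_real using nz by simp
    ultimately show "?c k * (LINT x|lborel. dual_hahn_weight (a + k) b (?z x)) = K * ?I * ((- 1) ^ k * of_nat (n choose k))"
      unfolding integral_dual_hahn_weight_moment[OF assms(1,2)] by (simp only: mult.assoc[symmetric]) (simp add: mult_ac)
  qed
  also have "\<dots> = K * ?I * (\<Sum>k\<le>n. (- 1) ^ k * of_nat (n choose k))"
    by (simp add: sum_distrib_left)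
  also have "\<dots> = 0"
    using choose_alternating_sum[OF assms(3), where 'a = complex] by simp
  finally show ?thesis .
qed

lemma integral_odd_eq_0:
  fixes f :: "real \<Rightarrow> complex"
  assumes "\<And>x. f (- x) = - f x"
  shows "(LINT x|lborel. f x) = 0"
proof -
  have "(LINT x|lborel. f x) = (LINT x|lborel. f (- x))"
    using lborel_integral_real_affine[of "- 1" f 0] by simp
  also have "\<dots> = - (LINT x|lborel. f x)" by (simp add: assms)
  finally show ?thesis by simp
qed

section \<open>The Bannai-Ito polynomials on the real line\<close>

theorem mainTheorem17:
  fixes r1 r2 \<rho>1 \<rho>2 a b :: real
    and u :: "nat \<Rightarrow> real" and w :: "real \<Rightarrow> real"
    and S :: "nat \<Rightarrow> complex poly"
  assumes "r1 < 1/4" and "r2 < 1/4"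
    and "(\<rho>1 = - r1 \<and> \<rho>2 = - r2) \<or> (\<rho>1 = - r2 \<and> \<rho>2 = - r1)"
    and "a = 1/2 - 2 * r1" and "b = 1/2 - 2 * r2"
    and S_eq: "\<And>n. S n = smult (\<i> powi (- int n)) (bannai_ito r1 r2 \<rho>1 \<rho>2 n \<circ>\<^sub>p [:- 1/4, \<i>:])"
    and u_eq: "\<And>n::nat. u n = (if even n then real n * (real n - 4 * (r1 + r2)) / 16
                              else (real n - 4 * r1) * (real n - 4 * r2) / 16)"
    and w_eq: "\<And>x::real. w x = (cmod (Gamma (of_real a + 2 * \<i> * of_real x) * Gamma (of_real b + 2 * \<i> * of_real x)
                                   / Gamma (1/2 + 2 * \<i> * of_real x)))\<^sup>2"
  shows "(\<forall>x. poly (S 1) x = x * poly (S 0) x)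
    \<and> (\<forall>n\<ge>1. \<forall>x. poly (S (n + 1)) x + of_real (u n) * poly (S (n - 1)) x = x * poly (S n) x)
    \<and> (\<forall>n\<ge>1. u n > 0)
    \<and> (\<forall>n x. poly (S (2 * n)) x =
          (-1) ^ n * 2 powi (- 2 * int n) * of_real (pochhammer a n * pochhammer (a + b) n)
          * hypergeom_3F2 (- of_nat n) (of_real a + 2 * \<i> * x) (of_real a - 2 * \<i> * x)
              (of_real a) (of_real (a + b)) 1)
    \<and> (\<forall>n x. poly (S (2 * n + 1)) x =
          (-1) ^ n * 2 powi (- 2 * int n) * of_real (pochhammer (a + 1) n * pochhammer (a + b) n) * x
          * hypergeom_3F2 (- of_nat n) (of_real a + 2 * \<i> * x) (of_real a - 2 * \<i> * x)
              (of_real (a + 1)) (of_real (a + b)) 1)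
    \<and> (\<forall>n x. poly (S (2 * n)) x =
          (-1) ^ n * 2 powi (- 2 * int n) * of_real (pochhammer a n * pochhammer (a + b) n)
          * cont_dual_hahn n ((2 * x)\<^sup>2) (of_real a) 0 (of_real b))
    \<and> (\<forall>n x. poly (S (2 * n + 1)) x =
          (-1) ^ n * 2 powi (- 2 * int n) * of_real (pochhammer (a + 1) n * pochhammer (a + b) n) * x
          * cont_dual_hahn n ((2 * x)\<^sup>2) (of_real a) 1 (of_real b))
    \<and> (\<forall>x. w x > 0)
    \<and> (\<forall>n m. integrable lborel
          (\<lambda>x. of_real (w x) * poly (S n) (of_real x) * poly (S m) (of_real x)))
    \<and> (\<forall>n m. n \<noteq> m \<longrightarrow>
          (LINT x|lborel. of_real (w x) * poly (S n) (of_real x) * poly (S m) (of_real x)) = 0)"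
proof -
  note r = \<open>r1 < 1/4\<close> \<open>r2 < 1/4\<close> and ab = \<open>a = 1/2 - 2 * r1\<close> \<open>b = 1/2 - 2 * r2\<close>
  define v where "v = (\<lambda>n. complex_of_real (u n))"
  have pos: "0 < a" "0 < b" using r ab by simp_all
  have a0: "complex_of_real a + of_nat k \<noteq> 0" for k :: nat
    using pos by (simp add: complex_eq_iff)
  have ab0: "complex_of_real a + of_real b + of_nat k \<noteq> 0" for k :: nat
    using pos by (simp add: complex_eq_iff)
  have v_even: "v (2 * n) = of_nat n * (of_nat n + of_real a + of_real b - 1) / 4" for n
    by (simp add: v_def u_eq ab field_simps)
  have v_odd: "v (2 * n + 1) = (of_nat n + of_real a) * (of_nat n + of_real b) / 4" for n
    by (simp add: v_def u_eq ab field_simps)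
  have S: "S n = monic_ops v n" for n
  proof -
    have inner: "[:- \<i> / 4, - \<i>:] \<circ>\<^sub>p [:- 1/4, \<i>:] = [:0, 1:]" by (simp add: pcompose_pCons)
    have "\<i> powi (- int n) * \<i> ^ n = 1" by (simp add: power_int_minus)
    then show ?thesis
      unfolding S_eq bannai_ito_eq_monic_ops[OF r assms(3) ab v_even v_odd]
      by (simp only: pcompose_smult pcompose_assoc[symmetric] inner pcompose_idR smult_smult smult_1_left)
  qed
  have recurrence: "poly (S (n + 1)) x + of_real (u n) * poly (S (n - 1)) x = x * poly (S n) x" if "n \<ge> 1" for n x
    using that by (cases n) (simp_all add: S v_def)
  have u_pos: "u n > 0" if "n \<ge> 1" for n
  proof -
    have "real n - 4 * r1 > 0" "real n - 4 * r2 > 0" using r that by linarith+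
    moreover have "real n - 4 * (r1 + r2) > 0" if "even n"
    proof -
      \<comment> \<open>\<open>n = 0\<close> is excluded by assumption and \<open>4 (r1 + r2)\<close> may come close to \<open>2\<close>\<close>
      have "n \<ge> 2" using that \<open>n \<ge> 1\<close> by (cases "n = 1") auto
      then have "real n \<ge> 2" by simp
      then show ?thesis using r by (simp add: distrib_left)
    qed
    ultimately show ?thesis using that by (simp add: u_eq)
  qed
  have quarter: "(- 1/4) ^ n = (-1) ^ n * (2 :: complex) powi (- 2 * int n)" for n
  proof -
    have "- 2 * int n = - int (2 * n)" by simp
    then have "(2 :: complex) powi (- 2 * int n) = inverse (2 ^ (2 * n))"
      by (simp only: power_int_minus power_int_of_nat)
    then have "(2 :: complex) powi (- 2 * int n) = (1/4) ^ n"
      by (simp only: power_mult) (simp add: power_one_over inverse_eq_divide)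
    moreover have "(- 1/4 :: complex) ^ n = (-1) ^ n * (1/4) ^ n"
      unfolding power_mult_distrib[symmetric] by simp
    ultimately show ?thesis by (simp only:)
  qed
  have S_even: "poly (S (2 * n)) x = hahn_sum (of_real a) (of_real a) (of_real a + of_real b) n (2 * \<i> * x)" for n x
    unfolding S by (rule poly_monic_ops_hahn(1)[OF a0 ab0 v_even v_odd])
  have S_odd: "poly (S (2 * n + 1)) x = x * hahn_sum (of_real a) (of_real a + 1) (of_real a + of_real b) n (2 * \<i> * x)" for n x
    unfolding S by (rule poly_monic_ops_hahn(2)[OF a0 ab0 v_even v_odd])
  have hyp_even: "poly (S (2 * n)) x =
          (-1) ^ n * 2 powi (- 2 * int n) * of_real (pochhammer a n * pochhammer (a + b) n)
          * hypergeom_3F2 (- of_nat n) (of_real a + 2 * \<i> * x) (of_real a - 2 * \<i> * x)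
              (of_real a) (of_real (a + b)) 1" for n x
    unfolding S_even hahn_sum_hypergeom quarter by (simp flip: pochhammer_of_real)
  have hyp_odd: "poly (S (2 * n + 1)) x =
          (-1) ^ n * 2 powi (- 2 * int n) * of_real (pochhammer (a + 1) n * pochhammer (a + b) n) * x
          * hypergeom_3F2 (- of_nat n) (of_real a + 2 * \<i> * x) (of_real a - 2 * \<i> * x)
              (of_real (a + 1)) (of_real (a + b)) 1" for n x
    unfolding S_odd hahn_sum_hypergeom quarter by (simp flip: pochhammer_of_real)
  have cdh_even: "cont_dual_hahn n ((2 * x)\<^sup>2) (of_real a) 0 (of_real b) =
      hypergeom_3F2 (- of_nat n) (of_real a + 2 * \<i> * x) (of_real a - 2 * \<i> * x) (of_real a) (of_real (a + b)) 1"
    and cdh_odd: "cont_dual_hahn n ((2 * x)\<^sup>2) (of_real a) 1 (of_real b) =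
      hypergeom_3F2 (- of_nat n) (of_real a + 2 * \<i> * x) (of_real a - 2 * \<i> * x) (of_real (a + 1)) (of_real (a + b)) 1" for n x
    unfolding cont_dual_hahn_power2 by (simp_all add: mult_ac)
  have w_pos: "w x > 0" for x
  proof -
    have "of_real c + 2 * \<i> * of_real x \<notin> \<int>\<^sub>\<le>\<^sub>0" if "c > 0" for c :: real
      by (rule not_nonpos_Ints_Re_pos) (use that in simp)
    from this[of a] this[of b] this[of "1/2"] show ?thesis
      using pos by (simp add: w_eq Gamma_eq_zero_iff)
  qed
  have w: "complex_of_real (w x) = dual_hahn_weight a b (2 * \<i> * of_real x)" for x
    unfolding w_eq by (rule dual_hahn_weight_on_line)
  have int: "integrable lborel (\<lambda>x. complex_of_real (w x) * poly p (of_real x))" for p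
    unfolding w by (rule integrable_dual_hahn_weight[OF pos])
  define \<Lambda> where "\<Lambda> = (\<lambda>p. LINT x|lborel. complex_of_real (w x) * poly p (of_real x))"
  have \<Lambda>_S: "\<Lambda> (monic_ops v n) = 0" if "n \<ge> 1" for n
  proof (cases "even n")
    case True
    then obtain k where k: "n = 2 * k" by (elim evenE)
    then have "k > 0" using that by simp
    then show ?thesis
      unfolding \<Lambda>_def w k S[symmetric] S_even by (rule integral_dual_hahn_weight_hahn_sum[OF pos])
  next
    case False
    then obtain k where k: "n = 2 * k + 1" by (elim oddE)
    show ?thesis
      unfolding \<Lambda>_def w k S[symmetric] S_odd
    proof (rule integral_odd_eq_0)
      fix x :: real
      have "2 * \<i> * complex_of_real (- x) = - (2 * \<i> * complex_of_real x)" by simp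
      then show "dual_hahn_weight a b (2 * \<i> * complex_of_real (- x)) * (complex_of_real (- x) * hahn_sum (of_real a) (of_real a + 1) (of_real a + of_real b) k (2 * \<i> * complex_of_real (- x)))
        = - (dual_hahn_weight a b (2 * \<i> * complex_of_real x) * (complex_of_real x * hahn_sum (of_real a) (of_real a + 1) (of_real a + of_real b) k (2 * \<i> * complex_of_real x)))"
        by (simp only: dual_hahn_weight_minus hahn_sum_minus) simp
    qed
  qed
  have \<Lambda>_add: "\<Lambda> (p + q) = \<Lambda> p + \<Lambda> q" for p q
    unfolding \<Lambda>_def poly_add distrib_left by (rule Bochner_Integration.integral_add[OF int int])
  have \<Lambda>_smult: "\<Lambda> (smult c p) = c * \<Lambda> p" for c p
    unfolding \<Lambda>_def poly_smult mult.left_commute[of _ c] by (rule integral_mult_right_zero)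
  have integrable: "integrable lborel (\<lambda>x. of_real (w x) * poly (S n) (of_real x) * poly (S m) (of_real x))" for n m
    using int[of "S n * S m"] by (simp add: mult.assoc)
  have prod: "(LINT x|lborel. of_real (w x) * poly (S n) (of_real x) * poly (S m) (of_real x)) = \<Lambda> (S n * S m)" for n m
    by (simp add: \<Lambda>_def mult.assoc)
  have orth: "\<Lambda> (S n * S m) = 0" if "n < m" for n m
    unfolding S by (rule monic_ops_orthogonal[where \<Lambda> = \<Lambda>]) (simp_all add: \<Lambda>_add \<Lambda>_smult \<Lambda>_S that)
  have orthogonal: "(LINT x|lborel. of_real (w x) * poly (S n) (of_real x) * poly (S m) (of_real x)) = 0" if "n \<noteq> m" for n m
    unfolding prod using orth[of n m] orth[of m n] that by (cases "n < m") (simp_all add: mult.commute)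
  show ?thesis
    unfolding cdh_even cdh_odd
    using recurrence u_pos hyp_even hyp_odd w_pos integrable orthogonal
    by (intro conjI allI impI) (simp_all add: S)
qed

end
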